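(* Let $\mathbf{A}\in\mathbb{F}^{d^n\times d^n}$ be any square matrix, and let $\boldsymbol{\omega}\in\mathbb{F}^{d^n}$ be a random matrix product state (rMPS) over $\mathbb{F}$ of order $n$, physical dimension $d$ and bond dimension $\chi$. When $\mathbb{F}=\mathbb{R}$, $$\operatorname{Var}(\boldsymbol{\omega}^\top\mathbf{A}\boldsymbol{\omega})\le 2\left(1+\frac1\chi\right)^{n-1}\|\mathbf{A}\|_{\rm F}^2+\left[3\left(1+\frac2\chi\right)^{n-1}-2\left(1+\frac1\chi\right)^{n-1}-1\right]\|\mathbf{A}\|_*^2 .$$ When $\mathbb{F}=\mathbb{C}$, $$\operatorname{Var}(\boldsymbol{\omega}^*\mathbf{A}\boldsymbol{\omega})\le \|\mathbf{A}\|_{\rm F}^2+2\left[\left(1+\frac1\chi\right)^{n-1}-1\right]\|\mathbf{A}\|_*^2 .$$ Both bounds are attained (hold with equality) when $\mathbf{A}$ is the matrix of all ones.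
   Context: $\mathbb{F}\in\{\mathbb{R},\mathbb{C}\}$. $\mathcal N_{\mathbb R}(0,\sigma^2)$ is the real centered normal law; $\mathcal N_{\mathbb C}(0,\sigma^2)$ is the law of $g_1+\mathrm{i}g_2$ with $g_1,g_2$ independent $\mathcal N_{\mathbb R}(0,\sigma^2/2)$. For a (possibly complex) random variable, $\operatorname{Var}(x)=\mathbb{E}[|x|^2]-|\mathbb{E}[x]|^2$. $\|\cdot\|_{\rm F}$ is the Frobenius norm, $\|\cdot\|_*$ the nuclear norm, $^*$ the adjoint. Let $d,\chi\ge1$ and $n\ge2$ be integers. A random matrix product state (rMPS) over $\mathbb{F}$ of order $n$, physical dimension $d$ and bond dimension $\chi$ is the random vector $\boldsymbol\omega\in\mathbb{F}^{d^n}$ with entries indexed by $(i_1,\dots,i_n)\in\{1,\dots,d\}^n$, $$\boldsymbol\omega(i_1,\dots,i_n)=\sum_{\alpha_1,\dots,\alpha_{n-1}=1}^{\chi}G_1(i_1,\alpha_1)\,G_2(\alpha_1,i_2,\alpha_2)\cdots G_{n-1}(\alpha_{n-2},i_{n-1},\alpha_{n-1})\,G_n(\alpha_{n-1},i_n),$$ where $G_1\in\mathbb{F}^{d\times\chi}$, $G_n\in\mathbb{F}^{\chi\times d}$, $G_p\in\mathbb{F}^{\chi\times d\times\chi}$ for $1<p<n$, and all entries of all cores are independent, the entries of $G_p$ having law $\mathcal N_{\mathbb F}(0,\sigma_p^2)$ with $\sigma_p^2=1/\chi$ for $1<p<n$ and $\sigma_p^2=1/\sqrt\chi$ for $p\in\{1,n\}$.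 *)

theory Defs
  imports
    "HOL-Probability.Probability"
    "Jordan_Normal_Form.Schur_Decomposition"
begin

(* Vectors and matrices are those of Jordan_Normal_Form, whose infix scalar product would
   otherwise be ambiguous with the inner product of HOL-Analysis. The vector binder is switched off to
   free the letter chi for the bond dimension. *)
no_notation inner (infix \<open>\<bullet>\<close> 70)
unbundle no vec_syntax

subsection \<open>Gaussian laws and variance\<close>

text \<open>The parameter of both laws is the variance (not the standard deviation) and is meant to be
  positive.\<close>

definition real_normal_law :: "real \<Rightarrow> real measure" where
  "real_normal_law v = density lborel (\<lambda>x. ennreal (normal_density 0 (sqrt v) x))"

definition complex_normal_law :: "real \<Rightarrow> complex measure" where
  "complex_normal_law v =
     distr (real_normal_law (v / 2) \<Otimes>\<^sub>M real_normal_law (v / 2)) borel (\<lambda>(x, y). Complex x y)"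

definition rv_variance ::
    "'w measure \<Rightarrow> ('w \<Rightarrow> 'a :: {banach, second_countable_topology}) \<Rightarrow> real" where
  "rv_variance M X = (\<integral>w. (norm (X w))\<^sup>2 \<partial>M) - (norm (\<integral>w. X w \<partial>M))\<^sup>2"

text \<open>The Bochner integral is 0 for non-integrable functions, so \<^const>\<open>rv_variance\<close> is the
  variance only for random variables with a finite second moment.\<close>

definition finite_variance ::
    "'w measure \<Rightarrow> ('w \<Rightarrow> 'a :: {banach, second_countable_topology}) \<Rightarrow> bool" where
  "finite_variance M X \<longleftrightarrow> X \<in> borel_measurable M \<and> integrable M (\<lambda>w. (norm (X w))\<^sup>2)"

subsection \<open>Matrix norms\<close>

definition frobenius_norm :: "'a :: real_normed_field mat \<Rightarrow> real" where
  "frobenius_norm A = sqrt (\<Sum>i<dim_row A. \<Sum>j<dim_col A. (norm (A $$ (i, j)))\<^sup>2)"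

text \<open>The singular values are the nonnegative square roots of the eigenvalues of the Gram matrix
  \<open>A\<^sup>* A\<close>; the nuclear norm is their sum with multiplicity. For real matrices
  \<^const>\<open>mat_adjoint\<close> is the transpose.\<close>

definition singular_values :: "'a :: {conjugatable_field, real_normed_field} mat \<Rightarrow> real set" where
  "singular_values A = {s. 0 \<le> s \<and> eigenvalue (mat_adjoint A * A) (of_real (s\<^sup>2))}"

definition singular_value_mult ::
    "'a :: {conjugatable_field, real_normed_field} mat \<Rightarrow> real \<Rightarrow> nat" where
  "singular_value_mult A s = Polynomial.order (of_real (s\<^sup>2)) (char_poly (mat_adjoint A * A))"

definition nuclear_norm :: "'a :: {conjugatable_field, real_normed_field} mat \<Rightarrow> real" where
  "nuclear_norm A = (\<Sum>s\<in>singular_values A. real (singular_value_mult A s) * s)"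

definition all_ones_mat :: "nat \<Rightarrow> 'a :: one mat" where
  "all_ones_mat N = mat N N (\<lambda>_. 1)"

subsection \<open>Random matrix product states\<close>

text \<open>The cores are numbered \<open>1, \<dots>, n\<close>; physical and bond indices start from 0. The first and
  last cores are matrices; they are treated like the middle ones by adding a trivial left
  (respectively right) bond of dimension 1, so that bond \<open>p\<close> links core \<open>p\<close> to core \<open>p + 1\<close> and
  bonds \<open>0\<close> and \<open>n\<close> are trivial. The entry \<open>(\<alpha>, i, \<beta>)\<close> of core \<open>p\<close> has label \<open>(p, \<alpha>, i, \<beta>)\<close>.\<close>

definition bond_dim :: "nat \<Rightarrow> nat \<Rightarrow> nat \<Rightarrow> nat" where
  "bond_dim n \<chi> p = (if p = 0 \<or> p = n then 1 else \<chi>)"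

definition core_entries :: "nat \<Rightarrow> nat \<Rightarrow> nat \<Rightarrow> (nat \<times> nat \<times> nat \<times> nat) set" where
  "core_entries n d \<chi> =
     {(p, \<alpha>, i, \<beta>). 1 \<le> p \<and> p \<le> n \<and> \<alpha> < bond_dim n \<chi> (p - 1) \<and> i < d \<and> \<beta> < bond_dim n \<chi> p}"

definition core_variance :: "nat \<Rightarrow> nat \<Rightarrow> nat \<Rightarrow> real" where
  "core_variance n \<chi> p = (if p = 1 \<or> p = n then 1 / sqrt (real \<chi>) else 1 / real \<chi>)"

definition mps_entry ::
    "nat \<Rightarrow> nat \<Rightarrow> (nat \<times> nat \<times> nat \<times> nat \<Rightarrow> 'a :: comm_ring_1) \<Rightarrow> (nat \<Rightarrow> nat) \<Rightarrow> 'a" where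
  "mps_entry n \<chi> G i =
     (\<Sum>\<alpha> \<in> (\<Pi>\<^sub>E p\<in>{0..n}. {..<bond_dim n \<chi> p}). \<Prod>p = 1..n. G (p, \<alpha> (p - 1), i p, \<alpha> p))"

text \<open>A position \<open>k < d ^ n\<close> stands for the multi-index \<open>(i\<^sub>1, \<dots>, i\<^sub>n)\<close> of its base-\<open>d\<close> digits,
  \<open>i\<^sub>1\<close> being the most significant one (lexicographic order).\<close>

definition multi_index :: "nat \<Rightarrow> nat \<Rightarrow> nat \<Rightarrow> nat \<Rightarrow> nat" where
  "multi_index n d k p = k div d ^ (n - p) mod d"

definition mps_vec ::
    "nat \<Rightarrow> nat \<Rightarrow> nat \<Rightarrow> (nat \<times> nat \<times> nat \<times> nat \<Rightarrow> 'a :: comm_ring_1) \<Rightarrow> 'a vec" where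
  "mps_vec n d \<chi> G = vec (d ^ n) (\<lambda>k. mps_entry n \<chi> G (multi_index n d k))"

text \<open>The parameter \<open>N\<close> is the family of centred normal laws over the scalar field, indexed by the
  variance: \<^const>\<open>real_normal_law\<close> or \<^const>\<open>complex_normal_law\<close>.\<close>

definition is_rmps ::
    "(real \<Rightarrow> 'a measure) \<Rightarrow> 'w measure \<Rightarrow> nat \<Rightarrow> nat \<Rightarrow> nat
      \<Rightarrow> ('w \<Rightarrow> 'a :: real_normed_field vec) \<Rightarrow> bool" where
  "is_rmps N M n d \<chi> \<omega> \<longleftrightarrow> prob_space M \<and>
     (\<exists>G :: nat \<times> nat \<times> nat \<times> nat \<Rightarrow> 'w \<Rightarrow> 'a.
        prob_space.indep_vars M (\<lambda>_. borel) G (core_entries n d \<chi>) \<and>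
        (\<forall>(p, \<alpha>, i, \<beta>) \<in> core_entries n d \<chi>.
           distr M borel (G (p, \<alpha>, i, \<beta>)) = N (core_variance n \<chi> p)) \<and>
        (\<forall>w\<in>space M. \<omega> w = mps_vec n d \<chi> (\<lambda>e. G e w)))"

end

theory Submission
  imports Defs
begin

text \<open>
\<^bold>\<open>Wick expansion.\<close> The square of the modulus of the form \<open>Q = \<Sum>\<^sub>i\<^sub>j A\<^sub>i\<^sub>j cnj(\<omega>\<^sub>i) \<omega>\<^sub>j\<close> is a
  combination of products \<open>cnj(\<omega>\<^sub>i) \<omega>\<^sub>j \<omega>\<^sub>k cnj(\<omega>\<^sub>l)\<close>, and each core enters such a product with exactly
  four of its entries. The expectation of such a product of four entries of one Gaussian core is its squared
  variance times the number of ways to pair the four positions so that paired entries coincide. There are three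
  pairings: (12)(34), (13)(24) and (14)(23), here \<open>Loops\<close>, \<open>Parallel\<close> and \<open>Crossed\<close>. The last one
  pairs two entries that are both conjugated or both unconjugated, so that it contributes for real
  cores and not for complex ones, where \<open>E z\<^sup>2 = 0\<close>. Expanding over all cores gives a sum over words
  \<open>q\<close> of \<open>n\<close> pairings. Summing out the bond indices leaves, for each inner bond, the factor \<open>1\<close> if the
  two adjacent letters agree and \<open>1/\<chi>\<close> if they differ (lemma \<open>bond_sum_pairings\<close>). Hence
  \<open>E \<bar>Q\<bar>\<^sup>2 = \<Sum>\<^sub>q weight(q) T\<^sub>q(A)\<close>, where \<open>T\<^sub>q(A)\<close> contracts \<open>A\<close> with its entrywise conjugate, the
  digits of the four indices at site \<open>p\<close> being identified according to the letter \<open>q p\<close>.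

  \<^bold>\<open>Bounding the contractions.\<close> The word of \<open>Loops\<close> only has weight \<open>1\<close> and contributes
  \<open>\<bar>tr A\<bar>\<^sup>2 = \<bar>E Q\<bar>\<^sup>2\<close>, so the variance is the sum over the remaining words (\<open>form_variance\<close>). If \<open>q\<close> has
  no letter \<open>Loops\<close>, the identifications only permute the entries of the second copy of \<open>A\<close>, and
  \<open>\<bar>T\<^sub>q(A)\<bar>\<close> is at most the squared Frobenius norm (\<open>contraction_frobenius_norm_bound\<close>). For any word,
  \<open>T\<^sub>q\<close> of two rank-one matrices is at most the product of the norms of the four vectors, by Cauchy-Schwarz
  one site at a time (\<open>contraction_vectors_bound\<close>). Writing \<open>A\<close> as a sum of rank-one matrices whose
  norms add up to the nuclear norm gives \<open>\<bar>T\<^sub>q(A)\<bar> \<le> \<parallel>A\<parallel>\<^sub>*\<^sup>2\<close> (\<open>contraction_nuclear_bound\<close>).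

  \<^bold>\<open>Counting.\<close> All words over \<open>r\<close> letters together have weight \<open>r (1 + (r - 1)/\<chi>)\<^sup>n\<^sup>-\<^sup>1\<close>
  (\<open>sum_word_weight\<close>), since appending a letter multiplies the total weight by \<open>1 + (r - 1)/\<chi>\<close>. Taking
  \<open>r = 3\<close> or \<open>r = 2\<close> for all words and \<open>r - 1\<close> for those without \<open>Loops\<close> yields the two bounds. For the
  matrix of ones of size \<open>N\<close> every contraction equals \<open>N\<^sup>2\<close>, and both norms equal \<open>N\<close>, so no inequality
  is lost.

  The two fields are treated together: a real family of cores is regarded as a complex one whose
  moments also allow the pairing \<open>Crossed\<close>.
\<close>

section \<open>Unitary diagonalisation and the nuclear norm\<close>

lemma dim_mat_adjoint [simp]:
  "dim_row (mat_adjoint A) = dim_col A" "dim_col (mat_adjoint A) = dim_row A"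
  by (simp_all add: mat_adjoint_def)

lemma mat_adjoint_index [simp]:
  "i < dim_col A \<Longrightarrow> j < dim_row A \<Longrightarrow> mat_adjoint A $$ (i, j) = conjugate (A $$ (j, i))"
  by (simp add: mat_adjoint_def mat_of_rows_index)

lemma mat_adjoint_carrier [simp]:
  "A \<in> carrier_mat n m \<Longrightarrow> mat_adjoint A \<in> carrier_mat m n"
  by (rule carrier_matI) auto

lemma mat_adjoint_adjoint [simp]: "mat_adjoint (mat_adjoint A) = A"
  by (rule eq_matI) auto

lemma mat_adjoint_mult:
  fixes A :: "complex mat"
  assumes "A \<in> carrier_mat n m" "B \<in> carrier_mat m k"
  shows "mat_adjoint (A * B) = mat_adjoint B * mat_adjoint A"
  using assms
  by (intro eq_matI) (auto simp: scalar_prod_def sum_conjugate conjugate_dist_mul mult.commute intro!: sum.cong)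

lemma mat_adjoint_four_block:
  assumes "A \<in> carrier_mat n1 m1" "B \<in> carrier_mat n1 m2" "C \<in> carrier_mat n2 m1" "D \<in> carrier_mat n2 m2"
  shows "mat_adjoint (four_block_mat A B C D)
    = four_block_mat (mat_adjoint A) (mat_adjoint C) (mat_adjoint B) (mat_adjoint D)"
  using assms by (intro eq_matI) auto

lemma mat_adjoint_one_zero [simp]:
  "mat_adjoint (1\<^sub>m n :: complex mat) = 1\<^sub>m n" "mat_adjoint (0\<^sub>m n m :: complex mat) = 0\<^sub>m m n"
  by (intro eq_matI; auto)+

text \<open>Gram-Schmidt produces vectors that are orthogonal but not of unit length. Normalising them keeps
  the first one a multiple of \<open>v\<close>, which is all that the deflation below requires of it.\<close>

lemma orthonormal_basis_extension:
  fixes v :: "complex vec"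
  assumes v: "v \<in> carrier_vec n" "v \<noteq> 0\<^sub>v n"
  shows "\<exists>W c. W \<in> carrier_mat n n \<and> mat_adjoint W * W = 1\<^sub>m n \<and> col W 0 = c \<cdot>\<^sub>v v"
proof -
  interpret cof_vec_space n "TYPE(complex)" .
  define b where "b = basis_completion v"
  from basis_completion[OF v, folded b_def]
  have dist_b: "distinct b" and indep: "\<not> lin_dep (set b)" and b: "set b \<subseteq> carrier_vec n"
    and hdb: "hd b = v" and len_b: "length b = n" by auto
  have n: "n > 0" using v by (metis carrier_vecD vec_of_dim_0 gr0I)
  from hdb len_b n obtain vs where bv: "b = v # vs" by (cases b, auto)
  define ws where "ws = gram_schmidt n b"
  from gram_schmidt_result[OF b dist_b indep refl, folded ws_def]
  have ws: "set ws \<subseteq> carrier_vec n" "corthogonal ws" "length ws = n" by (auto simp: len_b)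
  have hdws: "ws ! 0 = v"
    using gram_schmidt_hd[OF v(1), of vs, folded bv] ws(3) n
    unfolding ws_def by (metis hd_conv_nth length_0_conv less_irrefl)
  have wsc: "ws ! j \<in> carrier_vec n" if "j < n" for j using ws that by auto
  define q where "q j = (\<Sum>i<n. (cmod (ws ! j $ i))\<^sup>2)" for j
  have sp: "ws ! j \<bullet>c ws ! j = of_real (q j)" if "j < n" for j
    using wsc[OF that] by (simp add: scalar_prod_def q_def atLeast0LessThan complex_norm_square del: of_real_power)
  have qpos: "q j > 0" if "j < n" for j
  proof -
    have "ws ! j \<bullet>c ws ! j \<noteq> 0" using corthogonalD[OF ws(2)] ws(3) that by auto
    then have "q j \<noteq> 0" using sp[OF that] by auto
    moreover have "q j \<ge> 0" unfolding q_def by (intro sum_nonneg) auto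
    ultimately show ?thesis by simp
  qed
  define W where "W = mat n n (\<lambda>(i, j). of_real (1 / sqrt (q j)) * (ws ! j $ i))"
  have W: "W \<in> carrier_mat n n" by (simp add: W_def)
  have "mat_adjoint W * W = 1\<^sub>m n"
  proof (rule eq_matI)
    fix i j assume "i < dim_row (1\<^sub>m n :: complex mat)" "j < dim_col (1\<^sub>m n :: complex mat)"
    then have ij: "i < n" "j < n" by auto
    have "(mat_adjoint W * W) $$ (i, j)
        = (\<Sum>k<n. cnj (W $$ (k, i)) * W $$ (k, j))"
      using W ij by (auto simp: scalar_prod_def atLeast0LessThan)
    also have "\<dots> = of_real (1 / sqrt (q i)) * of_real (1 / sqrt (q j)) * (ws ! j \<bullet>c ws ! i)"
      using wsc[OF ij(1)] wsc[OF ij(2)] ij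
      by (simp add: W_def scalar_prod_def sum_distrib_left atLeast0LessThan ac_simps)
    also have "\<dots> = 1\<^sub>m n $$ (i, j)"
    proof (cases "i = j")
      case True
      have "complex_of_real (1 / sqrt (q j)) * of_real (1 / sqrt (q j)) * of_real (q j)
        = of_real (1 / sqrt (q j) * (1 / sqrt (q j)) * q j)" by (simp only: of_real_mult)
      also have "1 / sqrt (q j) * (1 / sqrt (q j)) * q j = 1"
        using qpos[OF ij(2)] by (simp add: field_simps)
      finally show ?thesis using True ij sp[OF ij(2)] by simp
    next
      case False
      then show ?thesis using corthogonalD[OF ws(2), of j i] ws(3) ij by auto
    qed
    finally show "(mat_adjoint W * W) $$ (i, j) = 1\<^sub>m n $$ (i, j)" .
  qed (use W in auto)
  moreover have "col W 0 = of_real (1 / sqrt (q 0)) \<cdot>\<^sub>v v"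
    using v n hdws by (intro eq_vecI) (auto simp: W_def)
  ultimately show ?thesis using W by blast
qed

text \<open>Deflation. In an orthonormal basis that starts with an eigenvector, the first column of \<open>H\<close>
  is a multiple of the first unit vector; as \<open>H\<close> is Hermitian so is its first row, and a smaller
  Hermitian matrix remains.\<close>

lemma hermitian_spectral:
  fixes H :: "complex mat"
  assumes "H \<in> carrier_mat n n" "mat_adjoint H = H"
  shows "\<exists>U d. U \<in> carrier_mat n n \<and> mat_adjoint U * U = 1\<^sub>m n \<and> H = U * mat_diag n d * mat_adjoint U"
  using assms
proof (induction n arbitrary: H)
  case 0
  then show ?case by (intro exI[of _ "1\<^sub>m 0"] exI) auto
next
  case (Suc n H)
  note H = Suc.prems
  obtain as where as: "char_poly H = (\<Prod>a\<leftarrow>as. [:- a, 1:])" "length as = Suc n"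
    using char_poly_factorized[OF H(1)] by blast
  then obtain e as' where "as = e # as'" by (cases as) auto
  then have "eigenvalue H e" unfolding eigenvalue_root_char_poly[OF H(1)] as by simp
  then obtain v where v: "v \<in> carrier_vec (Suc n)" "v \<noteq> 0\<^sub>v (Suc n)" "H *\<^sub>v v = e \<cdot>\<^sub>v v"
    unfolding eigenvalue_def eigenvector_def using H by auto
  from orthonormal_basis_extension[OF v(1,2)] obtain W c where W: "W \<in> carrier_mat (Suc n) (Suc n)"
    and W1: "mat_adjoint W * W = 1\<^sub>m (Suc n)" and c: "col W 0 = c \<cdot>\<^sub>v v" by blast
  have W': "mat_adjoint W \<in> carrier_mat (Suc n) (Suc n)" using W by simp
  have W2: "W * mat_adjoint W = 1\<^sub>m (Suc n)" using mat_mult_left_right_inverse[OF W' W W1] .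
  define K where "K = mat_adjoint W * (H * W)"
  have K: "K \<in> carrier_mat (Suc n) (Suc n)" unfolding K_def using W W' H by auto
  have K_herm: "mat_adjoint K = K"
    unfolding K_def using W W' H
    by (simp add: mat_adjoint_mult[of _ "Suc n" "Suc n" _ "Suc n"] assoc_mult_mat[of _ "Suc n" "Suc n" _ "Suc n" _ "Suc n"])
  have HWK: "H = W * K * mat_adjoint W"
  proof -
    have "W * K = (W * mat_adjoint W) * (H * W)" unfolding K_def
      using W W' H by (intro assoc_mult_mat[symmetric]) auto
    then have "W * K * mat_adjoint W = H * W * mat_adjoint W" using W2 W H by auto
    also have "\<dots> = H * (W * mat_adjoint W)" using W W' H by (intro assoc_mult_mat) auto
    finally show ?thesis using W2 H by auto
  qed
  have "col (H * W) 0 = e \<cdot>\<^sub>v col W 0"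
  proof -
    have "col (H * W) 0 = H *\<^sub>v col W 0" using H W by (intro eq_vecI) auto
    also have "\<dots> = c \<cdot>\<^sub>v (H *\<^sub>v v)" unfolding c using H v by (simp add: mult_mat_vec[of _ "Suc n" "Suc n"])
    also have "\<dots> = e \<cdot>\<^sub>v col W 0" unfolding c v(3) by (simp add: smult_smult_assoc mult.commute)
    finally show ?thesis .
  qed
  then have K0: "K $$ (i, 0) = e * (mat_adjoint W * W) $$ (i, 0)" if "i < Suc n" for i
    using that W W' H v by (simp add: K_def)
  have K_low: "K $$ (Suc i, 0) = 0" if "i < n" for i using K0[of "Suc i"] that W1 by simp
  have K_up: "K $$ (0, Suc i) = 0" if "i < n" for i
    using arg_cong[OF K_herm, of "\<lambda>X. X $$ (0, Suc i)"] K that K_low by auto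
  define K3 where "K3 = mat n n (\<lambda>(i, j). K $$ (Suc i, Suc j))"
  have K3: "K3 \<in> carrier_mat n n" by (simp add: K3_def)
  have Kb: "K = four_block_mat (mat_diag 1 (\<lambda>_. e)) (0\<^sub>m 1 n) (0\<^sub>m n 1) K3"
  proof (rule eq_matI)
    fix i j assume "i < dim_row (four_block_mat (mat_diag 1 (\<lambda>_. e)) (0\<^sub>m 1 n) (0\<^sub>m n 1) K3)"
      "j < dim_col (four_block_mat (mat_diag 1 (\<lambda>_. e)) (0\<^sub>m 1 n) (0\<^sub>m n 1) K3)"
    then have "i < Suc n" "j < Suc n" using K3 by (auto simp: mat_diag_def)
    then show "K $$ (i, j) = four_block_mat (mat_diag 1 (\<lambda>_. e)) (0\<^sub>m 1 n) (0\<^sub>m n 1) K3 $$ (i, j)"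
      using K0[of 0] W1 K_low K_up by (cases i; cases j) (auto simp: mat_diag_def K3_def)
  qed (use K K3 in \<open>auto simp: mat_diag_def\<close>)
  have "mat_adjoint K3 = K3"
  proof (rule eq_matI)
    fix i j assume "i < dim_row K3" "j < dim_col K3"
    then have ij: "i < n" "j < n" using K3 by auto
    show "mat_adjoint K3 $$ (i, j) = K3 $$ (i, j)"
      using arg_cong[OF K_herm, of "\<lambda>X. X $$ (Suc i, Suc j)"] K ij by (auto simp: K3_def)
  qed (use K3 in auto)
  from Suc.IH[OF K3 this] obtain U d where U: "U \<in> carrier_mat n n" "mat_adjoint U * U = 1\<^sub>m n"
    and K3U: "K3 = U * mat_diag n d * mat_adjoint U" by blast
  define V where "V = four_block_mat (1\<^sub>m 1) (0\<^sub>m 1 n) (0\<^sub>m n 1) U"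
  have V: "V \<in> carrier_mat (Suc n) (Suc n)"
    using four_block_carrier_mat[of "1\<^sub>m 1" 1 1 U n n] U by (simp add: V_def)
  have V': "mat_adjoint V = four_block_mat (1\<^sub>m 1) (0\<^sub>m 1 n) (0\<^sub>m n 1) (mat_adjoint U)"
    unfolding V_def using U by (subst mat_adjoint_four_block[of _ 1 1 _ n _ n]) auto
  define D where "D = mat_diag (Suc n) (\<lambda>i. case i of 0 \<Rightarrow> e | Suc j \<Rightarrow> d j)"
  have D: "D \<in> carrier_mat (Suc n) (Suc n)" by (simp add: D_def mat_diag_def)
  have Db: "D = four_block_mat (mat_diag 1 (\<lambda>_. e)) (0\<^sub>m 1 n) (0\<^sub>m n 1) (mat_diag n d)"
    unfolding D_def by (rule eq_matI) (auto simp: mat_diag_def split: nat.splits)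
  have "mat_adjoint V * V = four_block_mat (1\<^sub>m 1) (0\<^sub>m 1 n) (0\<^sub>m n 1) (1\<^sub>m n)"
    unfolding V' unfolding V_def
    using U by (subst mult_four_block_mat[of _ 1 1 _ n _ n _ _ 1 _ n]) auto
  also have "\<dots> = 1\<^sub>m (Suc n)" by (rule eq_matI) auto
  finally have V1: "mat_adjoint V * V = 1\<^sub>m (Suc n)" .
  have "V * D = four_block_mat (mat_diag 1 (\<lambda>_. e)) (0\<^sub>m 1 n) (0\<^sub>m n 1) (U * mat_diag n d)"
    unfolding V_def Db using U
    by (subst mult_four_block_mat[of _ 1 1 _ n _ n _ _ 1 _ n]) (auto simp: mat_diag_def)
  then have KV: "K = V * D * mat_adjoint V"
    unfolding V' Kb K3U using U
    by (simp, subst mult_four_block_mat[of _ 1 1 _ n _ n _ _ 1 _ n]) (auto simp: mat_diag_def)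
  have V'c: "mat_adjoint V \<in> carrier_mat (Suc n) (Suc n)" using V by simp
  have "mat_adjoint (W * V) * (W * V) = mat_adjoint V * ((mat_adjoint W * W) * V)"
    using W W' V V'c
    by (simp add: mat_adjoint_mult[of _ "Suc n" "Suc n" _ "Suc n"] assoc_mult_mat[of _ "Suc n" "Suc n" _ "Suc n" _ "Suc n"])
  then have "mat_adjoint (W * V) * (W * V) = 1\<^sub>m (Suc n)" using W1 V V1 by simp
  moreover have "H = W * V * D * mat_adjoint (W * V)"
    unfolding HWK KV using W W' V V'c D
    by (simp add: mat_adjoint_mult[of _ "Suc n" "Suc n" _ "Suc n"] mult_carrier_mat[of _ "Suc n" "Suc n" _ "Suc n"]
      assoc_mult_mat[of _ "Suc n" "Suc n" _ "Suc n" _ "Suc n"])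
  moreover have "W * V \<in> carrier_mat (Suc n) (Suc n)" using W V by simp
  ultimately show ?case unfolding D_def by blast
qed

lemma mat_adjoint_mult_index:
  fixes A B :: "complex mat"
  assumes "A \<in> carrier_mat m n" "B \<in> carrier_mat m k" "i < n" "j < k"
  shows "(mat_adjoint A * B) $$ (i, j) = (\<Sum>l<m. cnj (A $$ (l, i)) * B $$ (l, j))"
  using assms by (auto simp: scalar_prod_def atLeast0LessThan)

lemma order_prod_linear_factors:
  fixes f :: "'i \<Rightarrow> 'a :: field"
  assumes "finite S"
  shows "Polynomial.order x (\<Prod>i\<in>S. [:- f i, 1:]) = card {i \<in> S. f i = x}"
  using assms
proof (induction S)
  case (insert i S)
  have "Polynomial.order x [:- f i, 1:] = (if f i = x then 1 else 0)"
    using order_linear_power[of x "- f i" 1] by auto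
  moreover have "{j \<in> insert i S. f j = x} = (if f i = x then insert i {j \<in> S. f j = x} else {j \<in> S. f j = x})"
    by auto
  moreover have "[:- f i, 1:] * (\<Prod>i\<in>S. [:- f i, 1:]) \<noteq> 0"
    using insert.hyps by (simp only: mult_eq_0_iff prod_zero_iff) auto
  ultimately show ?case
    using insert order_mult[of "[:- f i, 1:]" "\<Prod>i\<in>S. [:- f i, 1:]" x]
    by (simp del: mult_pCons_left)
qed simp

text \<open>Grouping the indices \<open>m\<close> by the value of \<open>sqrt (l m)\<close> recovers the sum over the distinct singular
  values, because the multiplicity of a root counts the linear factors that vanish there.\<close>

lemma nuclear_norm_eq_sum:
  fixes A :: "complex mat"
  assumes A: "A \<in> carrier_mat n n"
    and cp: "char_poly (mat_adjoint A * A) = (\<Prod>m<n. [:- of_real (l m), 1:])"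
    and l: "\<And>m. m < n \<Longrightarrow> l m \<ge> 0"
  shows "nuclear_norm A = (\<Sum>m<n. sqrt (l m))"
proof -
  have H: "mat_adjoint A * A \<in> carrier_mat n n" by (rule mult_carrier_mat[OF mat_adjoint_carrier[OF A] A])
  have sv: "singular_values A = (\<lambda>m. sqrt (l m)) ` {..<n}"
  proof -
    have "s \<in> singular_values A \<longleftrightarrow> 0 \<le> s \<and> (\<exists>m<n. l m = s\<^sup>2)" for s
      unfolding singular_values_def mem_Collect_eq eigenvalue_root_char_poly[OF H] cp
      by (auto simp: poly_prod Bex_def eq_commute[of "s\<^sup>2"] simp del: of_real_power)
    moreover have "0 \<le> s \<and> (\<exists>m<n. l m = s\<^sup>2) \<longleftrightarrow> s \<in> (\<lambda>m. sqrt (l m)) ` {..<n}" for s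
      using l by (auto intro!: image_eqI)
    ultimately show ?thesis by blast
  qed
  have mult: "singular_value_mult A s = card {m\<in>{..<n}. sqrt (l m) = s}" if "s \<ge> 0" for s
  proof -
    have "singular_value_mult A s = card {m\<in>{..<n}. complex_of_real (l m) = of_real (s\<^sup>2)}"
      unfolding singular_value_mult_def cp by (simp add: order_prod_linear_factors del: of_real_power)
    also have "{m\<in>{..<n}. complex_of_real (l m) = of_real (s\<^sup>2)} = {m\<in>{..<n}. sqrt (l m) = s}"
      using l that by (auto simp del: of_real_power simp: of_real_eq_iff)
    finally show ?thesis .
  qed
  have "nuclear_norm A = (\<Sum>s\<in>singular_values A. \<Sum>m\<in>{m\<in>{..<n}. sqrt (l m) = s}. sqrt (l m))"
    unfolding nuclear_norm_def by (intro sum.cong) (auto simp: mult singular_values_def)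
  also have "\<dots> = (\<Sum>m<n. sqrt (l m))"
    unfolding sv by (rule sum.group) auto
  finally show ?thesis .
qed

text \<open>A singular value decomposition that avoids dividing by singular values: if \<open>U\<close> diagonalises
  \<open>A\<^sup>* A\<close>, the columns of \<open>A U\<close> are orthogonal and their lengths are the singular values.\<close>

lemma singular_system:
  fixes A :: "complex mat"
  assumes A: "A \<in> carrier_mat n n"
  shows "\<exists>U l. U \<in> carrier_mat n n \<and> mat_adjoint U * U = 1\<^sub>m n \<and> U * mat_adjoint U = 1\<^sub>m n
    \<and> mat_adjoint (A * U) * (A * U) = mat_diag n (\<lambda>m. of_real (l m))
    \<and> (\<forall>m<n. l m = (\<Sum>i<n. (cmod ((A * U) $$ (i, m)))\<^sup>2))
    \<and> nuclear_norm A = (\<Sum>m<n. sqrt (l m))"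
proof -
  define H where "H = mat_adjoint A * A"
  have A': "mat_adjoint A \<in> carrier_mat n n" using A by simp
  have H: "H \<in> carrier_mat n n" unfolding H_def by (rule mult_carrier_mat[OF A' A])
  have "mat_adjoint H = H" unfolding H_def using A A' by (simp add: mat_adjoint_mult[of _ n n _ n])
  from hermitian_spectral[OF H this] obtain U d where U: "U \<in> carrier_mat n n"
    and U1: "mat_adjoint U * U = 1\<^sub>m n" and HU: "H = U * mat_diag n d * mat_adjoint U" by blast
  have U': "mat_adjoint U \<in> carrier_mat n n" using U by simp
  have U2: "U * mat_adjoint U = 1\<^sub>m n" using mat_mult_left_right_inverse[OF U' U U1] .
  have D: "mat_diag n d \<in> carrier_mat n n" by (simp add: mat_diag_def)
  define B where "B = A * U"
  have B: "B \<in> carrier_mat n n" unfolding B_def using A U by simp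
  define l where "l m = (\<Sum>i<n. (cmod (B $$ (i, m)))\<^sup>2)" for m
  have "mat_adjoint B * B = mat_adjoint U * H * U"
    unfolding B_def H_def using A A' U U'
    by (simp add: mat_adjoint_mult[of _ n n _ n] mult_carrier_mat[of _ n n _ n] assoc_mult_mat[of _ n n _ n _ n])
  also have "\<dots> = (mat_adjoint U * U) * mat_diag n d * (mat_adjoint U * U)"
    unfolding HU using U U' D by (simp add: mult_carrier_mat[of _ n n _ n] assoc_mult_mat[of _ n n _ n _ n])
  finally have BB: "mat_adjoint B * B = mat_diag n d" using U1 D by simp
  have d: "d m = of_real (l m)" if "m < n" for m
  proof -
    have "d m = (mat_adjoint B * B) $$ (m, m)" using that by (simp add: BB mat_diag_def)
    also have "\<dots> = of_real (l m)"
      using that B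
      by (simp add: mat_adjoint_mult_index[of _ n n] l_def complex_norm_square mult.commute del: of_real_power index_mult_mat(1))
    finally show ?thesis .
  qed
  then have Dl: "mat_diag n d = mat_diag n (\<lambda>m. of_real (l m))"
    by (intro eq_matI) (auto simp: mat_diag_def)
  have "similar_mat H (mat_diag n d)"
    unfolding similar_mat_def using similar_mat_witI[OF U2 U1 HU H D U U'] by blast
  then have "char_poly H = char_poly (mat_diag n d)" by (rule char_poly_similar)
  also have "\<dots> = (\<Prod>a\<leftarrow>diag_mat (mat_diag n d). [:- a, 1:])"
    by (rule char_poly_upper_triangular[OF D]) (auto simp: mat_diag_def upper_triangular_def)
  also have "\<dots> = (\<Prod>m\<leftarrow>[0..<n]. [:- of_real (l m), 1:])"
    unfolding Dl by (rule arg_cong[of _ _ prod_list]) (auto simp: diag_mat_def mat_diag_def)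
  also have "\<dots> = (\<Prod>m<n. [:- of_real (l m), 1:])"
    by (subst prod.distinct_set_conv_list[symmetric]) (simp_all add: atLeast0LessThan)
  finally have "nuclear_norm A = (\<Sum>m<n. sqrt (l m))"
    unfolding H_def by (rule nuclear_norm_eq_sum[OF A]) (auto simp: l_def intro: sum_nonneg)
  then show ?thesis
    by (intro exI[of _ U] exI[of _ l] conjI U U1 U2 BB[unfolded Dl B_def]) (auto simp: l_def B_def)
qed

text \<open>The rank-one expansion \<open>A = (A U) U\<^sup>*\<close>. It is the only access to the nuclear norm in the variance bound: a
  bilinear quantity that is at most the product of the vector norms on rank-one matrices is at most the
  product of the nuclear norms in general.\<close>

lemma nuclear_decomposition:
  fixes A :: "complex mat"
  assumes A: "A \<in> carrier_mat n n"
  shows "\<exists>w v. (\<forall>i<n. \<forall>j<n. A $$ (i, j) = (\<Sum>m<n. w m i * cnj (v m j)))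
    \<and> (\<forall>m<n. L2_set (\<lambda>j. cmod (v m j)) {..<n} = 1)
    \<and> nuclear_norm A = (\<Sum>m<n. L2_set (\<lambda>i. cmod (w m i)) {..<n})"
proof -
  obtain U l where U: "U \<in> carrier_mat n n" "mat_adjoint U * U = 1\<^sub>m n" "U * mat_adjoint U = 1\<^sub>m n"
    and l: "\<forall>m<n. l m = (\<Sum>i<n. (cmod ((A * U) $$ (i, m)))\<^sup>2)" "nuclear_norm A = (\<Sum>m<n. sqrt (l m))"
    using singular_system[OF A] by blast
  have U': "mat_adjoint U \<in> carrier_mat n n" using U by simp
  show ?thesis
  proof (rule exI[of _ "\<lambda>m i. (A * U) $$ (i, m)"], rule exI[of _ "\<lambda>m j. U $$ (j, m)"], intro conjI allI impI)
    fix i j assume ij: "i < n" "j < n"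
    have "A = A * U * mat_adjoint U" using A U U' by (simp add: assoc_mult_mat[of _ n n _ n _ n])
    then have "A $$ (i, j) = (A * U * mat_adjoint U) $$ (i, j)" by simp
    also have "\<dots> = (\<Sum>m<n. (A * U) $$ (i, m) * cnj (U $$ (j, m)))"
      using ij A U by (simp add: scalar_prod_def atLeast0LessThan)
    finally show "A $$ (i, j) = (\<Sum>m<n. (A * U) $$ (i, m) * cnj (U $$ (j, m)))" .
  next
    fix m assume m: "m < n"
    have "complex_of_real (\<Sum>j<n. (cmod (U $$ (j, m)))\<^sup>2) = (mat_adjoint U * U) $$ (m, m)"
      using m U(1) by (simp add: mat_adjoint_mult_index[of _ n n] complex_norm_square mult.commute del: of_real_power index_mult_mat(1))
    also have "\<dots> = of_real 1" using m U by simp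
    finally show "L2_set (\<lambda>j. cmod (U $$ (j, m))) {..<n} = 1" unfolding L2_set_def of_real_eq_iff by simp
  next
    show "nuclear_norm A = (\<Sum>m<n. L2_set (\<lambda>i. cmod ((A * U) $$ (i, m))) {..<n})"
      unfolding l(2) L2_set_def using l(1) by (intro sum.cong) auto
  qed
qed

text \<open>Every column of \<open>J U\<close> is a multiple \<open>t m\<close> of the vector of ones, and the \<open>m\<close>-th singular value turns out to be
  \<open>\<bar>t m\<bar>\<^sup>2\<close>. These squares add up to \<open>n\<close> by Parseval, applied to the vector of ones.\<close>

lemma nuclear_norm_all_ones: "nuclear_norm (all_ones_mat n :: complex mat) = real n"
proof -
  define J :: "complex mat" where "J = all_ones_mat n"
  have J: "J \<in> carrier_mat n n" and J1: "\<And>i j. i < n \<Longrightarrow> j < n \<Longrightarrow> J $$ (i, j) = 1"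
    by (auto simp: J_def all_ones_mat_def)
  obtain U l where U: "U \<in> carrier_mat n n" "mat_adjoint U * U = 1\<^sub>m n" "U * mat_adjoint U = 1\<^sub>m n"
    and BB: "mat_adjoint (J * U) * (J * U) = mat_diag n (\<lambda>m. of_real (l m))"
    and l: "\<forall>m<n. l m = (\<Sum>i<n. (cmod ((J * U) $$ (i, m)))\<^sup>2)" "nuclear_norm J = (\<Sum>m<n. sqrt (l m))"
    using singular_system[OF J] by blast
  define t where "t m = (\<Sum>j<n. U $$ (j, m))" for m
  have JU: "(J * U) $$ (i, m) = t m" if "i < n" "m < n" for i m
    using that J U(1) by (simp add: scalar_prod_def t_def J1 atLeast0LessThan)
  have JUc: "J * U \<in> carrier_mat n n" using J U by simp
  have tt: "of_nat n * (cnj (t i) * t j) = (if i = j then of_real (l i) else 0)" if "i < n" "j < n" for i j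
    using arg_cong[OF BB, of "\<lambda>X. X $$ (i, j)"] that
    by (simp add: mat_adjoint_mult_index[OF JUc JUc] JU mat_diag_def del: index_mult_mat(1))
  have parseval: "(\<Sum>m<n. cnj (t m) * t m) = of_nat n"
  proof -
    have "(\<Sum>m<n. cnj (t m) * t m) = (\<Sum>m<n. \<Sum>i<n. \<Sum>j<n. U $$ (j, m) * cnj (U $$ (i, m)))"
      by (simp add: t_def sum_product mult.commute[of "U $$ _"])
    also have "\<dots> = (\<Sum>i<n. \<Sum>j<n. \<Sum>m<n. U $$ (j, m) * cnj (U $$ (i, m)))"
      by (subst sum.swap, intro sum.cong refl sum.swap)
    also have "\<dots> = (\<Sum>i<n. \<Sum>j<n. (U * mat_adjoint U) $$ (j, i))"
      using U(1) by (intro sum.cong refl) (auto simp: scalar_prod_def atLeast0LessThan)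
    also have "\<dots> = (\<Sum>i<n. \<Sum>j<n. if i = j then 1 else 0)"
      using U(3) by (intro sum.cong refl) auto
    finally show ?thesis by simp
  qed
  \<comment> \<open>The columns of \<open>J U\<close> are orthogonal multiples of one vector, so at most one of them is nonzero;
    by Parseval the corresponding \<open>\<bar>t m\<bar>\<^sup>2\<close> is then \<open>n\<close>, while \<open>l m = n \<bar>t m\<bar>\<^sup>2\<close>.\<close>
  have "sqrt (l m) = (cmod (t m))\<^sup>2" if m: "m < n" for m
  proof (cases "t m = 0")
    case True
    then show ?thesis using tt[OF m m] by simp
  next
    case False
    have n0: "n \<noteq> 0" using m by auto
    have "t j = 0" if "j < n" "j \<noteq> m" for j
      using tt[OF m that(1)] that(2) False n0 by auto
    then have "(\<Sum>j<n. cnj (t j) * t j) = (\<Sum>j<n. if j = m then cnj (t m) * t m else 0)"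
      by (intro sum.cong) auto
    then have "cnj (t m) * t m = of_nat n" using parseval m by simp
    moreover from this have "complex_of_real (l m) = of_nat n * of_nat n" using tt[OF m m] by simp
    ultimately have "complex_of_real ((cmod (t m))\<^sup>2) = complex_of_real (real n)"
      "complex_of_real (l m) = of_real (real n * real n)"
      by (simp_all add: complex_norm_square mult.commute del: of_real_power)
    then have "(cmod (t m))\<^sup>2 = real n" "l m = real n * real n" unfolding of_real_eq_iff by auto
    then show ?thesis by simp
  qed
  then have "nuclear_norm J = (\<Sum>m<n. (cmod (t m))\<^sup>2)" unfolding l(2) by (intro sum.cong) auto
  moreover have "complex_of_real (\<Sum>m<n. (cmod (t m))\<^sup>2) = of_real (real n)"
    using parseval by (simp add: complex_norm_square mult.commute del: of_real_power)
  ultimately show ?thesis unfolding of_real_eq_iff J_def by simp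
qed

lemma mat_adjoint_of_real:
  fixes A :: "real mat"
  shows "mat_adjoint (map_mat complex_of_real A) = map_mat of_real (mat_adjoint A)"
  by (rule eq_matI) auto

text \<open>The characteristic polynomials of the two Gram matrices have the same coefficients, hence the same real roots
  with the same orders.\<close>

lemma nuclear_norm_of_real:
  fixes A :: "real mat"
  assumes A: "A \<in> carrier_mat n n"
  shows "nuclear_norm (map_mat complex_of_real A) = nuclear_norm A"
proof -
  let ?H = "mat_adjoint A * A"
  have A': "mat_adjoint A \<in> carrier_mat n n" using A by simp
  have H: "?H \<in> carrier_mat n n" by (rule mult_carrier_mat[OF A' A])
  have HC: "mat_adjoint (map_mat complex_of_real A) * map_mat of_real A = map_mat of_real ?H"
    unfolding mat_adjoint_of_real using A A' by (simp add: of_real_hom.mat_hom_mult[of _ n n _ n])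
  have cp: "char_poly (map_mat complex_of_real ?H) = map_poly of_real (char_poly ?H)"
    by (rule of_real_hom.char_poly_hom[OF H])
  have HC_carrier: "map_mat complex_of_real ?H \<in> carrier_mat n n" using H by simp
  interpret map_poly_inj_idom_divide_hom complex_of_real ..
  have sv: "singular_values (map_mat complex_of_real A) = singular_values A"
    unfolding singular_values_def HC eigenvalue_root_char_poly[OF H] eigenvalue_root_char_poly[OF HC_carrier] cp
    by (simp del: of_real_power)
  have "singular_value_mult (map_mat complex_of_real A) s = singular_value_mult A s" for s
    unfolding singular_value_mult_def HC cp by (simp add: order_hom del: of_real_power)
  then show ?thesis unfolding nuclear_norm_def sv by simp
qed

lemma frobenius_norm_of_real:
  "frobenius_norm (map_mat complex_of_real A) = frobenius_norm A"
  by (simp add: frobenius_norm_def)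

section \<open>Pairings of four indices\<close>

text \<open>The indices \<open>i j k l\<close> stand for the positions of \<open>A\<^sub>i\<^sub>j cnj(A\<^sub>k\<^sub>l)\<close>. If each factor is drawn
  as an edge from its first to its second index, \<open>Loops\<close> closes both edges into loops and yields \<open>\<bar>tr A\<bar>\<^sup>2\<close>, \<open>Parallel\<close> lays
  one edge on the other and yields the squared Frobenius norm, and \<open>Crossed\<close> lays one edge on the reverse of the other.\<close>

datatype pairing = Loops | Parallel | Crossed

fun matched :: "pairing \<Rightarrow> 'a \<Rightarrow> 'a \<Rightarrow> 'a \<Rightarrow> 'a \<Rightarrow> bool" where
  "matched Loops i j k l \<longleftrightarrow> i = j \<and> k = l"
| "matched Parallel i j k l \<longleftrightarrow> i = k \<and> j = l"
| "matched Crossed i j k l \<longleftrightarrow> i = l \<and> j = k"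

lemma UNIV_pairing: "(UNIV :: pairing set) = {Loops, Parallel, Crossed}"
  using pairing.exhaust by blast

instance pairing :: finite
  by standard (simp add: UNIV_pairing)

lemma sum_of_bool_eq [simp]:
  fixes f :: "'a \<Rightarrow> 'b :: comm_semiring_1"
  assumes "finite B"
  shows "(\<Sum>x\<in>B. of_bool (x = y) * f x) = of_bool (y \<in> B) * f y"
    and "(\<Sum>x\<in>B. of_bool (y = x) * f x) = of_bool (y \<in> B) * f y"
proof -
  show 1: "(\<Sum>x\<in>B. of_bool (x = y) * f x) = of_bool (y \<in> B) * f y"
    using assms by (simp add: of_bool_def if_distrib[of "\<lambda>a. a * _"] cong: if_cong)
  then show "(\<Sum>x\<in>B. of_bool (y = x) * f x) = of_bool (y \<in> B) * f y"
    by (simp add: eq_commute[of y])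
qed

lemma sum_matched:
  fixes F :: "'a \<Rightarrow> 'a \<Rightarrow> 'a \<Rightarrow> 'a \<Rightarrow> 'b :: comm_semiring_1"
  assumes "finite B"
  shows "(\<Sum>i\<in>B. \<Sum>j\<in>B. \<Sum>k\<in>B. \<Sum>l\<in>B. of_bool (matched q i j k l) * F i j k l)
    = (\<Sum>s\<in>B. \<Sum>t\<in>B. case q of Loops \<Rightarrow> F s s t t | Parallel \<Rightarrow> F s t s t | Crossed \<Rightarrow> F s t t s)"
  using assms
  by (cases q) (simp_all add: of_bool_conj mult.assoc flip: sum_distrib_left)

lemma sum_PiE_insert:
  fixes F :: "('a \<Rightarrow> 'b) \<Rightarrow> 'c :: comm_monoid_add"
  assumes "p \<notin> S"
  shows "(\<Sum>f\<in>PiE (insert p S) B. F f) = (\<Sum>s\<in>B p. \<Sum>f\<in>PiE S B. F (f(p := s)))"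
proof -
  have "(\<Sum>f\<in>PiE (insert p S) B. F f) = (\<Sum>(s, f)\<in>B p \<times> PiE S B. F (f(p := s)))"
    using assms
    by (intro sum.reindex_bij_witness[of _ "\<lambda>(s, f). f(p := s)" "\<lambda>f. (f p, f(p := undefined))"])
       (auto simp: PiE_def extensional_def)
  then show ?thesis by (simp add: sum.cartesian_product)
qed

text \<open>Each pairing turns the sum into a product of two scalar products, to which the Cauchy-Schwarz inequality
  applies.\<close>

lemma single_site_bound:
  fixes u v x y :: "'a \<Rightarrow> real"
  assumes B: "finite B"
    and nonneg: "\<And>s. 0 \<le> u s" "\<And>s. 0 \<le> v s" "\<And>s. 0 \<le> x s" "\<And>s. 0 \<le> y s"
  shows "(\<Sum>i\<in>B. \<Sum>j\<in>B. \<Sum>k\<in>B. \<Sum>l\<in>B. of_bool (matched q i j k l) * (u i * v j * (x k * y l)))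
    \<le> L2_set u B * L2_set v B * (L2_set x B * L2_set y B)"
proof -
  have cs: "(\<Sum>s\<in>B. f s * g s) * (\<Sum>t\<in>B. h t * k t) \<le> L2_set f B * L2_set g B * (L2_set h B * L2_set k B)"
    if "\<And>s. 0 \<le> f s" "\<And>s. 0 \<le> g s" "\<And>s. 0 \<le> h s" "\<And>s. 0 \<le> k s" for f g h k :: "'a \<Rightarrow> real"
    using that L2_set_mult_ineq[of f g B] L2_set_mult_ineq[of h k B]
    by (intro mult_mono) (auto intro!: sum_nonneg)
  show ?thesis
    unfolding sum_matched[OF B]
    using cs[of u v x y] cs[of u x v y] cs[of u y v x] nonneg
    by (cases q) (simp_all add: sum_product ac_simps)
qed

lemma L2_set_PiE_insert:
  assumes "p \<notin> S"
  shows "L2_set u (PiE (insert p S) B) = L2_set (\<lambda>s. L2_set (\<lambda>f. u (f(p := s))) (PiE S B)) (B p)"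
  using assms by (simp add: L2_set_def sum_PiE_insert sum_nonneg)

text \<open>Induction on the sites. For fixed digits at the site \<open>p\<close>, the induction hypothesis bounds the sum over the other
  sites by the norms of the four slices; regarded as functions of the digit at \<open>p\<close>, these norms are vectors to
  which the bound for a single site applies, and the norm of the vector of slice norms is the full norm.\<close>

lemma contraction_vectors_bound:
  fixes u v x y :: "('p \<Rightarrow> 'b) \<Rightarrow> real"
  assumes "finite S" "finite B"
    and "\<And>f. 0 \<le> u f" "\<And>f. 0 \<le> v f" "\<And>f. 0 \<le> x f" "\<And>f. 0 \<le> y f"
  defines "X \<equiv> PiE S (\<lambda>_. B)"
  shows "(\<Sum>i\<in>X. \<Sum>j\<in>X. \<Sum>k\<in>X. \<Sum>l\<in>X. of_bool (\<forall>p\<in>S. matched (q p) (i p) (j p) (k p) (l p)) * (u i * v j * (x k * y l)))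
    \<le> L2_set u X * L2_set v X * (L2_set x X * L2_set y X)"
  using assms(1,3-6) unfolding X_def
proof (induction S arbitrary: u v x y)
  case empty
  then show ?case by (simp add: L2_set_def)
next
  case (insert p S)
  note p = insert.hyps(2)
  let ?X = "PiE S (\<lambda>_. B)"
  let ?N = "\<lambda>u s. L2_set (\<lambda>f. u (f(p := s))) ?X"
  let ?m = "\<lambda>i j k l. of_bool (\<forall>r\<in>S. matched (q r) (i r) (j r) (k r) (l r)) :: real"
  have upd: "of_bool (\<forall>r\<in>insert p S. matched (q r) ((i(p:=a)) r) ((j(p:=b)) r) ((k(p:=c)) r) ((l(p:=e)) r))
     = of_bool (matched (q p) a b c e) * ?m i j k l" for i j k l a b c e
    using p by (auto simp: of_bool_def)
  have "(\<Sum>i\<in>PiE (insert p S) (\<lambda>_. B). \<Sum>j\<in>PiE (insert p S) (\<lambda>_. B). \<Sum>k\<in>PiE (insert p S) (\<lambda>_. B). \<Sum>l\<in>PiE (insert p S) (\<lambda>_. B).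
      of_bool (\<forall>r\<in>insert p S. matched (q r) (i r) (j r) (k r) (l r)) * (u i * v j * (x k * y l)))
    = (\<Sum>a\<in>B. \<Sum>i\<in>?X. \<Sum>b\<in>B. \<Sum>j\<in>?X. \<Sum>c\<in>B. \<Sum>k\<in>?X. \<Sum>e\<in>B. \<Sum>l\<in>?X. of_bool (matched (q p) a b c e) *
       (?m i j k l * (u (i(p:=a)) * v (j(p:=b)) * (x (k(p:=c)) * y (l(p:=e))))))"
    unfolding sum_PiE_insert[OF p] upd by (simp only: mult.assoc)
  also have "\<dots> = (\<Sum>a\<in>B. \<Sum>b\<in>B. \<Sum>c\<in>B. \<Sum>e\<in>B. of_bool (matched (q p) a b c e) *
      (\<Sum>i\<in>?X. \<Sum>j\<in>?X. \<Sum>k\<in>?X. \<Sum>l\<in>?X. ?m i j k l * (u (i(p:=a)) * v (j(p:=b)) * (x (k(p:=c)) * y (l(p:=e))))))"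
    unfolding sum_distrib_left sum.swap[of _ B ?X] ..
  also have "\<dots> \<le> (\<Sum>a\<in>B. \<Sum>b\<in>B. \<Sum>c\<in>B. \<Sum>e\<in>B. of_bool (matched (q p) a b c e) * (?N u a * ?N v b * (?N x c * ?N y e)))"
    by (intro sum_mono mult_left_mono insert.IH) (use insert.prems in auto)
  also have "\<dots> \<le> L2_set (?N u) B * L2_set (?N v) B * (L2_set (?N x) B * L2_set (?N y) B)"
    by (rule single_site_bound[OF \<open>finite B\<close>]) auto
  finally show ?case using p by (simp add: L2_set_PiE_insert)
qed

lemma of_bool_ball: "finite S \<Longrightarrow> (\<Prod>p\<in>S. of_bool (P p)) = (of_bool (\<forall>p\<in>S. P p) :: 'a :: comm_semiring_1)"
  by (induction S rule: finite_induct) auto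

lemma sum_PiE_prod4:
  fixes h :: "'p \<Rightarrow> 'b \<Rightarrow> 'b \<Rightarrow> 'b \<Rightarrow> 'b \<Rightarrow> 'c :: comm_semiring_1"
  assumes "finite S" "\<And>p. p \<in> S \<Longrightarrow> finite (B p)"
  defines "X \<equiv> PiE S B"
  shows "(\<Sum>i\<in>X. \<Sum>j\<in>X. \<Sum>k\<in>X. \<Sum>l\<in>X. \<Prod>p\<in>S. h p (i p) (j p) (k p) (l p))
    = (\<Prod>p\<in>S. \<Sum>a\<in>B p. \<Sum>b\<in>B p. \<Sum>c\<in>B p. \<Sum>e\<in>B p. h p a b c e)"
  unfolding X_def using assms(1,2) by (simp add: prod_sum_PiE)

lemma sum_swap_pairs:
  "(\<Sum>i\<in>A. \<Sum>j\<in>B. \<Sum>k\<in>C. \<Sum>l\<in>D. f i j k l) = (\<Sum>k\<in>C. \<Sum>l\<in>D. \<Sum>i\<in>A. \<Sum>j\<in>B. f i j k l)"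
proof -
  have "(\<Sum>x\<in>A \<times> B. \<Sum>y\<in>C \<times> D. f (fst x) (snd x) (fst y) (snd y))
    = (\<Sum>y\<in>C \<times> D. \<Sum>x\<in>A \<times> B. f (fst x) (snd x) (fst y) (snd y))" by (rule sum.swap)
  then show ?thesis by (simp only: sum.cartesian_product' fst_conv snd_conv)
qed

text \<open>In the absence of \<open>Loops\<close>, the indices \<open>i\<close> and \<open>j\<close> determine \<open>k\<close> and \<open>l\<close> and conversely. After bounding the
  product of the two factors by half the sum of their squares, each of the two squares contributes half of the
  right-hand side.\<close>

lemma contraction_frobenius_bound:
  fixes a :: "('p \<Rightarrow> 'b) \<Rightarrow> ('p \<Rightarrow> 'b) \<Rightarrow> real"
  assumes S: "finite S" and B: "finite B" and q: "\<And>p. p \<in> S \<Longrightarrow> q p \<noteq> Loops"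
  defines "X \<equiv> PiE S (\<lambda>_. B)"
  shows "(\<Sum>i\<in>X. \<Sum>j\<in>X. \<Sum>k\<in>X. \<Sum>l\<in>X. of_bool (\<forall>p\<in>S. matched (q p) (i p) (j p) (k p) (l p)) * (a i j * a k l))
    \<le> (\<Sum>i\<in>X. \<Sum>j\<in>X. (a i j)\<^sup>2)"
proof -
  let ?m = "\<lambda>i j k l. of_bool (\<forall>p\<in>S. matched (q p) (i p) (j p) (k p) (l p)) :: real"
  have fX: "finite X" unfolding X_def using S B by (auto intro: finite_PiE)
  have one: "(\<Sum>k\<in>X. \<Sum>l\<in>X. \<Prod>p\<in>S. g p (k p) (l p)) = (1 :: real)"
    if "\<And>p. p \<in> S \<Longrightarrow> (\<Sum>c\<in>B. \<Sum>e\<in>B. g p c e) = 1" for g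
    proof -
    have "(\<Sum>k\<in>X. \<Sum>l\<in>X. \<Prod>p\<in>S. g p (k p) (l p)) = (\<Prod>p\<in>S. \<Sum>c\<in>B. \<Sum>e\<in>B. g p c e)"
      unfolding X_def using S B by (simp add: prod_sum_PiE)
    then show ?thesis using that by simp
  qed
  have m: "?m i j k l = (\<Prod>p\<in>S. of_bool (matched (q p) (i p) (j p) (k p) (l p)))" for i j k l
    using S by (simp add: of_bool_ball)
  have one1: "(\<Sum>k\<in>X. \<Sum>l\<in>X. ?m i j k l) = 1" if "i \<in> X" "j \<in> X" for i j
    unfolding m
  proof (rule one)
    fix p assume p: "p \<in> S"
    then have "i p \<in> B" "j p \<in> B" using that by (auto simp: X_def)
    then show "(\<Sum>c\<in>B. \<Sum>e\<in>B. of_bool (matched (q p) (i p) (j p) c e)) = (1::real)"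
      using B q[OF p] sum_of_bool_eq[where f="\<lambda>_. 1::real" and B=B]
      by (cases "q p") (simp_all add: of_bool_conj flip: sum_distrib_left sum_distrib_right)
  qed
  have one2: "(\<Sum>i\<in>X. \<Sum>j\<in>X. ?m i j k l) = 1" if "k \<in> X" "l \<in> X" for k l
    unfolding m
  proof (rule one)
    fix p assume p: "p \<in> S"
    then have "k p \<in> B" "l p \<in> B" using that by (auto simp: X_def)
    then show "(\<Sum>c\<in>B. \<Sum>e\<in>B. of_bool (matched (q p) c e (k p) (l p))) = (1::real)"
      using B q[OF p] sum_of_bool_eq[where f="\<lambda>_. 1::real" and B=B]
      by (cases "q p") (simp_all add: of_bool_conj flip: sum_distrib_left sum_distrib_right)
  qed
  have "(\<Sum>i\<in>X. \<Sum>j\<in>X. \<Sum>k\<in>X. \<Sum>l\<in>X. ?m i j k l * (a i j * a k l))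
    \<le> (\<Sum>i\<in>X. \<Sum>j\<in>X. \<Sum>k\<in>X. \<Sum>l\<in>X. ?m i j k l * (((a i j)\<^sup>2 + (a k l)\<^sup>2) / 2))"
  proof (intro sum_mono mult_left_mono)
    fix i j k l
    have "0 \<le> (a i j - a k l)\<^sup>2" by simp
    then show "a i j * a k l \<le> ((a i j)\<^sup>2 + (a k l)\<^sup>2) / 2" by (simp add: power2_diff)
  qed simp
  also have "\<dots> = (\<Sum>i\<in>X. \<Sum>j\<in>X. (a i j)\<^sup>2 / 2 * (\<Sum>k\<in>X. \<Sum>l\<in>X. ?m i j k l))
      + (\<Sum>i\<in>X. \<Sum>j\<in>X. \<Sum>k\<in>X. \<Sum>l\<in>X. (a k l)\<^sup>2 / 2 * ?m i j k l)"
    by (simp add: sum_distrib_left sum.distrib algebra_simps add_divide_distrib)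
  also have "(\<Sum>i\<in>X. \<Sum>j\<in>X. \<Sum>k\<in>X. \<Sum>l\<in>X. (a k l)\<^sup>2 / 2 * ?m i j k l)
     = (\<Sum>k\<in>X. \<Sum>l\<in>X. (a k l)\<^sup>2 / 2 * (\<Sum>i\<in>X. \<Sum>j\<in>X. ?m i j k l))"
    by (subst sum_swap_pairs) (simp add: sum_distrib_left)
  also have "\<dots> = (\<Sum>k\<in>X. \<Sum>l\<in>X. (a k l)\<^sup>2 / 2)" by (intro sum.cong refl) (simp add: one2)
  also have "(\<Sum>i\<in>X. \<Sum>j\<in>X. (a i j)\<^sup>2 / 2 * (\<Sum>k\<in>X. \<Sum>l\<in>X. ?m i j k l)) = (\<Sum>k\<in>X. \<Sum>l\<in>X. (a k l)\<^sup>2 / 2)"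
    by (intro sum.cong refl) (simp add: one1)
  also have "(\<Sum>k\<in>X. \<Sum>l\<in>X. (a k l)\<^sup>2 / 2) + (\<Sum>k\<in>X. \<Sum>l\<in>X. (a k l)\<^sup>2 / 2) = (\<Sum>k\<in>X. \<Sum>l\<in>X. (a k l)\<^sup>2)"
    by (simp flip: sum.distrib)
  finally show ?thesis .
qed

section \<open>Words of pairings and bond sums\<close>

definition word_weight :: "nat \<Rightarrow> nat \<Rightarrow> (nat \<Rightarrow> pairing) \<Rightarrow> real" where
  "word_weight n \<chi> q = (\<Prod>p = 1..<n. if q p = q (Suc p) then 1 else 1 / real \<chi>)"

lemma word_weight_nonneg: "0 \<le> word_weight n \<chi> q"
  unfolding word_weight_def by (intro prod_nonneg) auto

lemma word_weight_const: "word_weight n \<chi> (\<lambda>p\<in>{1..n}. c) = 1"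
  unfolding word_weight_def by (intro prod.neutral) auto

text \<open>Appending a letter multiplies the weight by \<open>1\<close> if the last letter is repeated, and by \<open>1/\<chi>\<close> for each of the
  other \<open>card P - 1\<close> letters.\<close>

lemma sum_word_weight:
  assumes "1 \<le> n" and P: "P \<noteq> {}"
  shows "(\<Sum>q\<in>PiE {1..n} (\<lambda>_. P). word_weight n \<chi> q)
    = real (card P) * (1 + (real (card P) - 1) / real \<chi>) ^ (n - 1)"
  using \<open>1 \<le> n\<close>
proof (induction n rule: nat_induct_at_least)
  case base
  then show ?case by (simp add: word_weight_def card_PiE)
next
  case (Suc n)
  have step: "(\<Sum>s\<in>P. if q n = s then 1 else 1 / real \<chi>) = 1 + (real (card P) - 1) / real \<chi>"
    if "q \<in> PiE {1..n} (\<lambda>_. P)" for q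
  proof -
    have "q n \<in> P" using that Suc.hyps by auto
    have "(\<Sum>s\<in>P - {q n}. if q n = s then 1 else 1 / real \<chi>) = (\<Sum>s\<in>P - {q n}. 1 / real \<chi>)"
      by (rule sum.cong) auto
    then have "(\<Sum>s\<in>P. if q n = s then 1 else 1 / real \<chi>) = 1 + (\<Sum>s\<in>P - {q n}. 1 / real \<chi>)"
      by (subst sum.remove[OF _ \<open>q n \<in> P\<close>]) simp_all
    moreover have "real (card (P - {q n})) = real (card P) - 1"
      using \<open>q n \<in> P\<close> by (metis card_Suc_Diff1 diff_add_cancel finite add.commute of_nat_Suc add_diff_cancel_left')
    ultimately show ?thesis by simp
  qed
  have w: "word_weight (Suc n) \<chi> (q(Suc n := s)) = word_weight n \<chi> q * (if q n = s then 1 else 1 / real \<chi>)"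
    for q s
  proof -
    have "word_weight (Suc n) \<chi> (q(Suc n := s))
      = (\<Prod>p = 1..<n. if (q(Suc n := s)) p = (q(Suc n := s)) (Suc p) then 1 else 1 / real \<chi>)
        * (if q n = s then 1 else 1 / real \<chi>)"
      using Suc.hyps by (simp add: word_weight_def prod.atLeastLessThan_Suc)
    also have "(\<Prod>p = 1..<n. if (q(Suc n := s)) p = (q(Suc n := s)) (Suc p) then 1 else 1 / real \<chi>) = word_weight n \<chi> q"
      unfolding word_weight_def by (intro prod.cong) auto
    finally show ?thesis .
  qed
  have "{1..Suc n} = insert (Suc n) {1..n}" by auto
  then have "(\<Sum>q\<in>PiE {1..Suc n} (\<lambda>_. P). word_weight (Suc n) \<chi> q)
    = (\<Sum>s\<in>P. \<Sum>q\<in>PiE {1..n} (\<lambda>_. P). word_weight (Suc n) \<chi> (q(Suc n := s)))"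
    by (simp add: sum_PiE_insert)
  also have "\<dots> = (\<Sum>q\<in>PiE {1..n} (\<lambda>_. P). word_weight n \<chi> q * (\<Sum>s\<in>P. if q n = s then 1 else 1 / real \<chi>))"
    unfolding w by (subst sum.swap) (simp add: sum_distrib_left)
  also have "\<dots> = (\<Sum>q\<in>PiE {1..n} (\<lambda>_. P). word_weight n \<chi> q) * (1 + (real (card P) - 1) / real \<chi>)"
    by (simp add: step sum_distrib_right)
  also have "\<dots> = real (card P) * (1 + (real (card P) - 1) / real \<chi>) ^ (Suc n - 1)"
    using Suc.IH Suc.hyps by (cases n) auto
  finally show ?case .
qed

text \<open>Equal pairings leave two free indices; two different pairings connect all four positions and leave one.\<close>

lemma sum_matched_matched:
  assumes "finite B"
  shows "(\<Sum>i\<in>B. \<Sum>j\<in>B. \<Sum>k\<in>B. \<Sum>l\<in>B. of_bool (matched q i j k l) * of_bool (matched r i j k l))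
    = (if q = r then real (card B) ^ 2 else real (card B))"
proof -
  have [simp]: "(s = t \<and> t = s) = (s = t)" for s t :: 'a by auto
  show ?thesis
    unfolding sum_matched[OF assms] using assms
    by (cases q; cases r) (simp_all add: power2_eq_square of_bool_def)
qed

lemma sum_matched_one:
  assumes "finite B"
  shows "(\<Sum>i\<in>B. \<Sum>j\<in>B. \<Sum>k\<in>B. \<Sum>l\<in>B. of_bool (matched q i j k l)) = real (card B) ^ 2"
  using sum_matched_matched[OF assms, of q q] by (simp flip: of_bool_conj)

text \<open>Regroups a product over cores, each with a factor for its left bond \<open>p - 1\<close> and one for its right bond \<open>p\<close>, by
  bonds. The two outer bonds belong to one core each.\<close>

lemma prod_over_cores:
  fixes g h :: "nat \<Rightarrow> 'b :: comm_monoid_mult"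
  shows "(\<Prod>p = 1..n. g (p - 1) * h p)
    = (\<Prod>p = 0..n. (if p < n then g p else 1) * (if 1 \<le> p then h p else 1))"
proof -
  have "(\<Prod>p = 1..n. g (p - 1)) = (\<Prod>p = 0..n. if p < n then g p else 1)"
  proof -
    have "(\<Prod>p = 1..n. g (p - 1)) = (\<Prod>p\<in>{..<n}. g p)"
      by (rule prod.reindex_bij_witness[of _ Suc "\<lambda>p. p - 1"]) auto
    also have "\<dots> = (\<Prod>p = 0..n. if p < n then g p else 1)"
      by (rule prod.mono_neutral_cong_left) auto
    finally show ?thesis .
  qed
  moreover have "(\<Prod>p = 1..n. h p) = (\<Prod>p = 0..n. if 1 \<le> p then h p else 1)"
    by (rule prod.mono_neutral_cong_left) auto
  ultimately show ?thesis by (simp add: prod.distrib)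
qed

text \<open>After regrouping by bonds the sum factorises. An inner bond carries the pairings of its two adjacent cores, with the
  normalisation \<open>1/\<chi>\<^sup>2\<close>, and contributes \<open>\<chi>\<^sup>2/\<chi>\<^sup>2\<close> or \<open>\<chi>/\<chi>\<^sup>2\<close>; the outer bonds have dimension 1 and contribute 1.\<close>

lemma bond_sum_pairings:
  fixes q :: "nat \<Rightarrow> pairing"
  assumes n: "2 \<le> n" and \<chi>: "1 \<le> \<chi>"
  defines "D \<equiv> bond_dim n \<chi>"
  defines "X \<equiv> PiE {0..n} (\<lambda>p. {..<D p})"
  shows "(\<Sum>\<alpha>\<in>X. \<Sum>\<beta>\<in>X. \<Sum>\<gamma>\<in>X. \<Sum>\<delta>\<in>X. \<Prod>p = 1..n.
      of_bool (matched (q p) (\<alpha> (p-1)) (\<beta> (p-1)) (\<gamma> (p-1)) (\<delta> (p-1))) / real (D (p-1))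
      * (of_bool (matched (q p) (\<alpha> p) (\<beta> p) (\<gamma> p) (\<delta> p)) / real (D p))) = word_weight n \<chi> q"
proof -
  \<comment> \<open>The factor of bond \<open>p\<close>: it is the left bond of core \<open>p + 1\<close> and the right bond of core \<open>p\<close>, whichever
    of the two cores exist.\<close>
  define h where "h p a b c e =
     (if p < n then of_bool (matched (q (Suc p)) a b c e) / real (D p) else 1)
     * (if 1 \<le> p then of_bool (matched (q p) a b c e) / real (D p) else 1)" for p and a b c e :: nat
  have "(\<Prod>p = 1..n. of_bool (matched (q p) (\<alpha> (p-1)) (\<beta> (p-1)) (\<gamma> (p-1)) (\<delta> (p-1))) / real (D (p-1))
      * (of_bool (matched (q p) (\<alpha> p) (\<beta> p) (\<gamma> p) (\<delta> p)) / real (D p)))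
    = (\<Prod>p = 0..n. h p (\<alpha> p) (\<beta> p) (\<gamma> p) (\<delta> p))" for \<alpha> \<beta> \<gamma> \<delta> :: "nat \<Rightarrow> nat"
    unfolding h_def
    by (subst prod_over_cores[symmetric, where g = "\<lambda>p. of_bool (matched (q (Suc p)) (\<alpha> p) (\<beta> p) (\<gamma> p) (\<delta> p)) / real (D p)"])
       (intro prod.cong, auto)
  then have "(\<Sum>\<alpha>\<in>X. \<Sum>\<beta>\<in>X. \<Sum>\<gamma>\<in>X. \<Sum>\<delta>\<in>X. \<Prod>p = 1..n.
      of_bool (matched (q p) (\<alpha> (p-1)) (\<beta> (p-1)) (\<gamma> (p-1)) (\<delta> (p-1))) / real (D (p-1))
      * (of_bool (matched (q p) (\<alpha> p) (\<beta> p) (\<gamma> p) (\<delta> p)) / real (D p)))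
    = (\<Prod>p = 0..n. \<Sum>a<D p. \<Sum>b<D p. \<Sum>c<D p. \<Sum>e<D p. h p a b c e)"
    unfolding X_def by (simp only:) (rule sum_PiE_prod4, auto)
  also have "\<dots> = (\<Prod>p = 1..<n. if q p = q (Suc p) then 1 else 1 / real \<chi>)"
  proof (rule prod.mono_neutral_cong_right)
    show "\<forall>p\<in>{0..n} - {1..<n}. (\<Sum>a<D p. \<Sum>b<D p. \<Sum>c<D p. \<Sum>e<D p. h p a b c e) = 1"
    proof
      fix p assume "p \<in> {0..n} - {1..<n}"
      then have "p = 0 \<or> p = n" by auto
      moreover have "matched r 0 0 0 0" for r by (cases r) auto
      ultimately show "(\<Sum>a<D p. \<Sum>b<D p. \<Sum>c<D p. \<Sum>e<D p. h p a b c e) = 1"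
        using n by (auto simp: h_def D_def bond_dim_def)
    qed
  next
    fix p assume p: "p \<in> {1..<n}"
    then have D: "D p = \<chi>" by (auto simp: D_def bond_dim_def)
    have hp: "h p a b c e = of_bool (matched (q (Suc p)) a b c e) * of_bool (matched (q p) a b c e) / (real \<chi>)\<^sup>2"
      for a b c e using p by (simp add: h_def D power2_eq_square)
    have "(\<Sum>a<D p. \<Sum>b<D p. \<Sum>c<D p. \<Sum>e<D p. h p a b c e)
      = (\<Sum>a<\<chi>. \<Sum>b<\<chi>. \<Sum>c<\<chi>. \<Sum>e<\<chi>. of_bool (matched (q (Suc p)) a b c e) * of_bool (matched (q p) a b c e)) / (real \<chi>)\<^sup>2"
      unfolding D hp by (simp only: sum_divide_distrib)
    also have "\<dots> = (if q p = q (Suc p) then 1 else 1 / real \<chi>)"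
      using \<chi> by (subst sum_matched_matched) (auto simp: power2_eq_square)
    finally show "(\<Sum>a<D p. \<Sum>b<D p. \<Sum>c<D p. \<Sum>e<D p. h p a b c e) = (if q p = q (Suc p) then 1 else 1 / real \<chi>)" .
  qed auto
  finally show ?thesis by (simp add: word_weight_def)
qed

text \<open>Each inner bond occurs in two factors, each time with a square root. The outer bonds occur once, which
  is harmless because their dimension is 1.\<close>

lemma prod_bond_dim:
  "(\<Prod>p = 1..n. 1 / (sqrt (real (bond_dim n \<chi> (p - 1))) * sqrt (real (bond_dim n \<chi> p))))
    = 1 / (\<Prod>p = 0..n. real (bond_dim n \<chi> p))"
proof -
  let ?D = "\<lambda>p. real (bond_dim n \<chi> p)"
  have "(\<Prod>p = 1..n. sqrt (?D (p - 1)) * sqrt (?D p))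
    = (\<Prod>p = 0..n. (if p < n then sqrt (?D p) else 1) * (if 1 \<le> p then sqrt (?D p) else 1))"
    by (rule prod_over_cores)
  also have "\<dots> = (\<Prod>p = 0..n. ?D p)" by (rule prod.cong) (auto simp: bond_dim_def)
  finally show ?thesis by (simp add: prod_dividef)
qed

section \<open>Contractions of matrices indexed by multi-indices\<close>

lemma digits_eqD:
  fixes d :: nat
  assumes "\<And>r. r < n \<Longrightarrow> k div d ^ r mod d = l div d ^ r mod d" "k < d ^ n" "l < d ^ n"
  shows "k = l"
  using assms
proof (induction n arbitrary: k l)
  case (Suc n)
  have "k div d div d ^ r mod d = l div d div d ^ r mod d" if "r < n" for r
    using Suc.prems(1)[of "Suc r"] that by (simp add: div_mult2_eq)
  moreover have "k div d < d ^ n" "l div d < d ^ n"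
    using Suc.prems(2,3) by (simp_all add: less_mult_imp_div_less mult.commute)
  ultimately have "k div d = l div d" by (rule Suc.IH)
  moreover have "k mod d = l mod d" using Suc.prems(1)[of 0] by simp
  ultimately show ?case by (metis div_mult_mod_eq)
qed auto

lemma bij_betw_multi_index:
  assumes d: "1 \<le> d"
  shows "bij_betw (\<lambda>k. restrict (multi_index n d k) {1..n}) {..<d ^ n} (PiE {1..n} (\<lambda>_. {..<d}))"
proof -
  let ?h = "\<lambda>k. restrict (multi_index n d k) {1..n}"
  have inj: "inj_on ?h {..<d ^ n}"
  proof (rule inj_onI)
    fix k l assume kl: "k \<in> {..<d ^ n}" "l \<in> {..<d ^ n}" "?h k = ?h l"
    show "k = l"
    proof (rule digits_eqD)
      fix r assume "r < n"
      then have "n - r \<in> {1..n}" "n - (n - r) = r" by auto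
      then show "k div d ^ r mod d = l div d ^ r mod d"
        using fun_cong[OF kl(3), of "n - r"] by (simp add: multi_index_def)
    qed (use kl in auto)
  qed
  have sub: "?h ` {..<d ^ n} \<subseteq> PiE {1..n} (\<lambda>_. {..<d})"
    using d by (auto simp: multi_index_def)
  have "card (?h ` {..<d ^ n}) = card (PiE {1..n} (\<lambda>_. {..<d}))"
    using card_image[OF inj] by (simp add: card_PiE)
  with sub have "?h ` {..<d ^ n} = PiE {1..n} (\<lambda>_. {..<d})"
    by (intro card_subset_eq finite_PiE) auto
  with inj show ?thesis by (simp add: bij_betw_def)
qed

lemma multi_index_inverse:
  assumes "1 \<le> d"
  obtains g where "bij_betw g (PiE {1..n} (\<lambda>_. {..<d})) {..<d ^ n}"
    and "\<forall>i\<in>PiE {1..n} (\<lambda>_. {..<d}). \<forall>p\<in>{1..n}. multi_index n d (g i) p = i p"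
proof -
  let ?X = "PiE {1..n} (\<lambda>_. {..<d})"
  define h where "h = (\<lambda>k. restrict (multi_index n d k) {1..n})"
  have h: "bij_betw h {..<d ^ n} ?X" unfolding h_def by (rule bij_betw_multi_index[OF assms])
  define g where "g = inv_into {..<d ^ n} h"
  have g: "bij_betw g ?X {..<d ^ n}" unfolding g_def by (rule bij_betw_inv_into[OF h])
  have "multi_index n d (g i) p = i p" if "i \<in> ?X" "p \<in> {1..n}" for i p
  proof -
    have "h (g i) = i" unfolding g_def by (rule bij_betw_inv_into_right[OF h that(1)])
    then show ?thesis using that(2) by (metis h_def restrict_apply')
  qed
  with g show thesis by (intro that) auto
qed

text \<open>The quantity called \<open>T\<^sub>q\<close> in the introduction, for an arbitrary tensor \<open>F\<close> in place of \<open>A\<^sub>i\<^sub>j cnj(A\<^sub>k\<^sub>l)\<close>.\<close>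

definition contraction :: "nat \<Rightarrow> nat \<Rightarrow> (nat \<Rightarrow> pairing) \<Rightarrow> (nat \<Rightarrow> nat \<Rightarrow> nat \<Rightarrow> nat \<Rightarrow> 'a) \<Rightarrow> 'a :: comm_semiring_1" where
  "contraction n d q F = (\<Sum>i<d ^ n. \<Sum>j<d ^ n. \<Sum>k<d ^ n. \<Sum>l<d ^ n.
     of_bool (\<forall>p\<in>{1..n}. matched (q p) (multi_index n d i p) (multi_index n d j p)
       (multi_index n d k p) (multi_index n d l p)) * F i j k l)"

lemma contraction_sum:
  "contraction n d q (\<lambda>i j k l. \<Sum>m\<in>M. F m i j k l) = (\<Sum>m\<in>M. contraction n d q (F m))"
  unfolding contraction_def sum_distrib_left sum.swap[of _ M "{..<d ^ n}"] ..

lemma contraction_eq_multi_index_sum: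
  assumes g: "bij_betw g (PiE {1..n} (\<lambda>_. {..<d})) {..<d ^ n}"
    and digits: "\<forall>i\<in>PiE {1..n} (\<lambda>_. {..<d}). \<forall>p\<in>{1..n}. multi_index n d (g i) p = i p"
  defines "X \<equiv> PiE {1..n} (\<lambda>_. {..<d})"
  shows "contraction n d q F = (\<Sum>i\<in>X. \<Sum>j\<in>X. \<Sum>k\<in>X. \<Sum>l\<in>X.
     of_bool (\<forall>p\<in>{1..n}. matched (q p) (i p) (j p) (k p) (l p)) * F (g i) (g j) (g k) (g l))"
proof -
  have "(\<forall>p\<in>{1..n}. matched (q p) (multi_index n d (g i) p) (multi_index n d (g j) p)
       (multi_index n d (g k) p) (multi_index n d (g l) p))
     \<longleftrightarrow> (\<forall>p\<in>{1..n}. matched (q p) (i p) (j p) (k p) (l p))"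
    if "i \<in> X" "j \<in> X" "k \<in> X" "l \<in> X" for i j k l
    by (rule ball_cong[OF refl]) (simp only: digits[rule_format] that[unfolded X_def])
  note * = arg_cong2[where f = times, OF arg_cong[where f = of_bool, OF this] refl]
  show ?thesis
    unfolding contraction_def sum.reindex_bij_betw[OF g, symmetric] X_def[symmetric]
    by (intro sum.cong refl *)
qed

lemma contraction_rank_one_bound:
  assumes "1 \<le> d" and nonneg: "\<And>s. 0 \<le> u s" "\<And>s. 0 \<le> v s" "\<And>s. 0 \<le> x s" "\<And>s. 0 \<le> y s"
  shows "contraction n d q (\<lambda>i j k l. u i * v j * (x k * y l) :: real)
    \<le> L2_set u {..<d ^ n} * L2_set v {..<d ^ n} * (L2_set x {..<d ^ n} * L2_set y {..<d ^ n})"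
proof -
  obtain g where g: "bij_betw g (PiE {1..n} (\<lambda>_. {..<d})) {..<d ^ n}"
    and digits: "\<forall>i\<in>PiE {1..n} (\<lambda>_. {..<d}). \<forall>p\<in>{1..n}. multi_index n d (g i) p = i p"
    by (rule multi_index_inverse[OF assms(1), where n = n]) (rule that)
  have L: "L2_set z {..<d ^ n} = L2_set (\<lambda>i. z (g i)) (PiE {1..n} (\<lambda>_. {..<d}))" for z
    unfolding L2_set_def sum.reindex_bij_betw[OF g, symmetric] ..
  show ?thesis
    unfolding contraction_eq_multi_index_sum[OF g digits] L
    by (rule contraction_vectors_bound) (auto simp: nonneg)
qed

lemma contraction_square_bound:
  assumes "1 \<le> d" and q: "\<And>p. p \<in> {1..n} \<Longrightarrow> q p \<noteq> Loops"
  shows "contraction n d q (\<lambda>i j k l. a i j * a k l :: real) \<le> (\<Sum>i<d ^ n. \<Sum>j<d ^ n. (a i j)\<^sup>2)"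
proof -
  obtain g where g: "bij_betw g (PiE {1..n} (\<lambda>_. {..<d})) {..<d ^ n}"
    and digits: "\<forall>i\<in>PiE {1..n} (\<lambda>_. {..<d}). \<forall>p\<in>{1..n}. multi_index n d (g i) p = i p"
    by (rule multi_index_inverse[OF assms(1), where n = n]) (rule that)
  show ?thesis
    unfolding contraction_eq_multi_index_sum[OF g digits] sum.reindex_bij_betw[OF g, symmetric]
    by (rule contraction_frobenius_bound) (auto simp: q)
qed

lemma contraction_ones:
  assumes "1 \<le> d"
  shows "contraction n d q (\<lambda>i j k l. 1 :: real) = (real (d ^ n))\<^sup>2"
proof -
  obtain g where g: "bij_betw g (PiE {1..n} (\<lambda>_. {..<d})) {..<d ^ n}"
    and digits: "\<forall>i\<in>PiE {1..n} (\<lambda>_. {..<d}). \<forall>p\<in>{1..n}. multi_index n d (g i) p = i p"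
    by (rule multi_index_inverse[OF assms(1), where n = n]) (rule that)
  have "contraction n d q (\<lambda>i j k l. 1 :: real)
    = (\<Prod>p\<in>{1..n}. \<Sum>a<d. \<Sum>b<d. \<Sum>c<d. \<Sum>e<d. of_bool (matched (q p) a b c e))"
    unfolding contraction_eq_multi_index_sum[OF g digits] mult_1_right of_bool_ball[OF finite_atLeastAtMost, symmetric]
    by (rule sum_PiE_prod4) auto
  also have "\<dots> = (real (d ^ n))\<^sup>2"
    by (simp only: sum_matched_one finite_lessThan card_lessThan prod_constant card_atLeastAtMost
        power_mult[symmetric] of_nat_power mult.commute diff_Suc_1 Suc_eq_plus1[symmetric])
  finally show ?thesis .
qed

lemma multi_index_eqD:
  assumes "1 \<le> d" "i < d ^ n" "j < d ^ n" "\<forall>p\<in>{1..n}. multi_index n d i p = multi_index n d j p"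
  shows "i = j"
proof -
  have "restrict (multi_index n d i) {1..n} = restrict (multi_index n d j) {1..n}"
    using assms(4) by (intro restrict_ext) auto
  then show ?thesis using bij_betw_imp_inj_on[OF bij_betw_multi_index[OF assms(1), of n]] assms(2,3)
    by (auto dest: inj_onD)
qed

lemma contraction_loops:
  assumes "1 \<le> d" "\<And>p. p \<in> {1..n} \<Longrightarrow> q p = Loops"
  shows "contraction n d q F = (\<Sum>i<d ^ n. \<Sum>k<d ^ n. F i i k k :: 'a :: comm_semiring_1)"
proof -
  have "(\<forall>p\<in>{1..n}. matched (q p) (multi_index n d i p) (multi_index n d j p)
       (multi_index n d k p) (multi_index n d l p)) \<longleftrightarrow> matched Loops i j k l"
    if "i < d ^ n" "j < d ^ n" "k < d ^ n" "l < d ^ n" for i j k l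
    using multi_index_eqD[OF assms(1), of i n j] multi_index_eqD[OF assms(1), of k n l] that assms(2)
    by auto
  note * = arg_cong2[where f = times, OF arg_cong[where f = of_bool, OF this] refl]
  have "contraction n d q F = (\<Sum>i<d ^ n. \<Sum>j<d ^ n. \<Sum>k<d ^ n. \<Sum>l<d ^ n. of_bool (matched Loops i j k l) * F i j k l)"
    unfolding contraction_def by (intro sum.cong refl *) auto
  then show ?thesis by (simp only: sum_matched[OF finite_lessThan] pairing.case)
qed

lemma contraction_norm_le:
  fixes F :: "nat \<Rightarrow> nat \<Rightarrow> nat \<Rightarrow> nat \<Rightarrow> complex"
  shows "cmod (contraction n d q F) \<le> contraction n d q (\<lambda>i j k l. cmod (F i j k l))"
  unfolding contraction_def by (intro sum_norm_le) (simp add: norm_mult)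

text \<open>Both copies of \<open>A\<close> are expanded into rank-one matrices, and the contraction is bounded for each pair
  of them.\<close>

lemma contraction_nuclear_bound:
  fixes A :: "complex mat"
  assumes d: "1 \<le> d" and A: "A \<in> carrier_mat (d ^ n) (d ^ n)"
  shows "cmod (contraction n d q (\<lambda>i j k l. A $$ (i, j) * cnj (A $$ (k, l)))) \<le> (nuclear_norm A)\<^sup>2"
proof -
  let ?N = "d ^ n"
  obtain w v where wv: "\<And>i j. i < ?N \<Longrightarrow> j < ?N \<Longrightarrow> A $$ (i, j) = (\<Sum>m<?N. w m i * cnj (v m j))"
    and v: "\<And>m. m < ?N \<Longrightarrow> L2_set (\<lambda>j. cmod (v m j)) {..<?N} = 1"
    and nuc: "nuclear_norm A = (\<Sum>m<?N. L2_set (\<lambda>i. cmod (w m i)) {..<?N})"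
    using nuclear_decomposition[OF A] by blast
  let ?F = "\<lambda>m m' i j k l. cmod (w m i) * cmod (v m j) * (cmod (w m' k) * cmod (v m' l))"
  have "cmod (contraction n d q (\<lambda>i j k l. A $$ (i, j) * cnj (A $$ (k, l))))
    \<le> contraction n d q (\<lambda>i j k l. cmod (A $$ (i, j) * cnj (A $$ (k, l))))"
    by (rule contraction_norm_le)
  also have "\<dots> \<le> contraction n d q (\<lambda>i j k l. \<Sum>m<?N. \<Sum>m'<?N. ?F m m' i j k l)"
    unfolding contraction_def
  proof (intro sum_mono mult_left_mono)
    fix i j k l assume "i \<in> {..<?N}" "j \<in> {..<?N}" "k \<in> {..<?N}" "l \<in> {..<?N}"
    then have 1: "cmod (A $$ (i, j)) \<le> (\<Sum>m<?N. cmod (w m i) * cmod (v m j))"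
      and 2: "cmod (A $$ (k, l)) \<le> (\<Sum>m<?N. cmod (w m k) * cmod (v m l))"
      by (simp_all add: wv sum_norm_le norm_mult)
    show "cmod (A $$ (i, j) * cnj (A $$ (k, l))) \<le> (\<Sum>m<?N. \<Sum>m'<?N. ?F m m' i j k l)"
      using mult_mono[OF 1 2] by (simp add: sum_product sum_nonneg norm_mult)
  qed simp
  also have "\<dots> = (\<Sum>m<?N. \<Sum>m'<?N. contraction n d q (?F m m'))"
    by (simp only: contraction_sum)
  also have "\<dots> \<le> (\<Sum>m<?N. \<Sum>m'<?N. L2_set (\<lambda>i. cmod (w m i)) {..<?N} * L2_set (\<lambda>i. cmod (w m' i)) {..<?N})"
  proof (intro sum_mono)
    fix m m' assume "m \<in> {..<?N}" "m' \<in> {..<?N}"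
    then show "contraction n d q (?F m m') \<le> L2_set (\<lambda>i. cmod (w m i)) {..<?N} * L2_set (\<lambda>i. cmod (w m' i)) {..<?N}"
      using contraction_rank_one_bound[OF d, of "\<lambda>i. cmod (w m i)" "\<lambda>i. cmod (v m i)" "\<lambda>i. cmod (w m' i)" "\<lambda>i. cmod (v m' i)" n q]
      by (simp add: v)
  qed
  also have "\<dots> = (nuclear_norm A)\<^sup>2" unfolding nuc by (simp add: power2_eq_square sum_product)
  finally show ?thesis .
qed

lemma contraction_frobenius_norm_bound:
  fixes A :: "complex mat"
  assumes d: "1 \<le> d" and A: "A \<in> carrier_mat (d ^ n) (d ^ n)"
    and q: "\<And>p. p \<in> {1..n} \<Longrightarrow> q p \<noteq> Loops"
  shows "cmod (contraction n d q (\<lambda>i j k l. A $$ (i, j) * cnj (A $$ (k, l)))) \<le> (frobenius_norm A)\<^sup>2"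
proof -
  have "cmod (contraction n d q (\<lambda>i j k l. A $$ (i, j) * cnj (A $$ (k, l))))
    \<le> contraction n d q (\<lambda>i j k l. cmod (A $$ (i, j)) * cmod (A $$ (k, l)))"
    using contraction_norm_le[of n d q "\<lambda>i j k l. A $$ (i, j) * cnj (A $$ (k, l))"] by (simp add: norm_mult)
  also have "\<dots> \<le> (\<Sum>i<d ^ n. \<Sum>j<d ^ n. (cmod (A $$ (i, j)))\<^sup>2)"
    by (rule contraction_square_bound[OF d q])
  also have "\<dots> = (frobenius_norm A)\<^sup>2"
    using A by (auto simp: frobenius_norm_def sum_nonneg)
  finally show ?thesis .
qed

section \<open>Moments of the core entries\<close>

text \<open>The real and the complex normal law in one description. Complex cores have \<open>P = {Loops, Parallel}\<close>, with
  \<open>E z\<^sup>2 = 0\<close> and \<open>E \<bar>z\<bar>\<^sup>4 = 2 v\<^sup>2\<close>; real cores allow all three pairings, with \<open>E z\<^sup>2 = v\<close> and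
  \<open>E z\<^sup>4 = 3 v\<^sup>2\<close>. The order of the factors is that of \<open>cnj(\<omega>\<^sub>i) \<omega>\<^sub>j \<omega>\<^sub>k cnj(\<omega>\<^sub>l)\<close>.\<close>

definition gaussian_moments :: "'w measure \<Rightarrow> pairing set \<Rightarrow> real \<Rightarrow> ('w \<Rightarrow> complex) \<Rightarrow> bool" where
  "gaussian_moments M P v X \<longleftrightarrow> X \<in> borel_measurable M \<and> integrable M (\<lambda>w. cmod (X w) ^ 4)
     \<and> (\<integral>w. X w \<partial>M) = 0
     \<and> (\<integral>w. cnj (X w) * X w \<partial>M) = of_real v
     \<and> (\<integral>w. X w * X w \<partial>M) = of_bool (Crossed \<in> P) * of_real v
     \<and> (\<integral>w. cnj (X w) * X w * (X w * cnj (X w)) \<partial>M) = of_nat (card P) * of_real (v\<^sup>2)"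

text \<open>The factor that an entry \<open>z\<close> contributes to \<open>cnj(x\<^sub>1) x\<^sub>2 x\<^sub>3 cnj(x\<^sub>4)\<close>, when the four flags
  tell which of the four positions it occupies. With all flags off the factor is 1, so that such a product can be
  written as a product over all entries, which are independent.\<close>

definition slots :: "bool \<Rightarrow> bool \<Rightarrow> bool \<Rightarrow> bool \<Rightarrow> complex \<Rightarrow> complex" where
  "slots a b c e z = (if a then cnj z else 1) * (if b then z else 1) * ((if c then z else 1) * (if e then cnj z else 1))"

lemma slots_measurable [measurable]: "slots a b c e \<in> borel_measurable borel"
proof -
  have "continuous_on UNIV (slots a b c e)"
    unfolding slots_def by (cases a; cases b; cases c; cases e) (auto intro!: continuous_intros)
  then show ?thesis by (rule borel_measurable_continuous_onI)
qed

lemma norm_slots_le: "cmod (slots a b c e z) \<le> 1 + cmod z ^ 4"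
proof -
  \<comment> \<open>Each of the four factors has modulus at most \<open>?x\<close>, and \<open>?x\<^sup>4\<close> is either 1 or the fourth power.\<close>
  let ?x = "max 1 (cmod z)"
  have f: "cmod (if b then u else 1) \<le> ?x" if "cmod u = cmod z" for b u using that by auto
  have "cmod (slots a b c e z) \<le> ?x * ?x * (?x * ?x)"
    unfolding slots_def norm_mult by (intro mult_mono f) (auto intro: mult_nonneg_nonneg)
  also have "\<dots> \<le> 1 + cmod z ^ 4"
    by (cases "cmod z \<le> 1") (auto simp: max_def power4_eq_xxxx mult.assoc)
  finally show ?thesis .
qed

lemma integrable_slots:
  assumes "finite_measure M" "gaussian_moments M P v X"
  shows "integrable M (\<lambda>w. slots a b c e (X w))"
proof (rule Bochner_Integration.integrable_bound)
  interpret finite_measure M by fact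
  show "integrable M (\<lambda>w. 1 + cmod (X w) ^ 4)"
    using assms(2) by (auto simp: gaussian_moments_def)
  have [measurable]: "X \<in> borel_measurable M" using assms(2) by (simp add: gaussian_moments_def)
  show "(\<lambda>w. slots a b c e (X w)) \<in> borel_measurable M" by measurable
  have "norm (slots a b c e (X w)) \<le> norm (1 + cmod (X w) ^ 4)" for w
    using norm_slots_le[of a b c e "X w"] by (simp add: abs_of_nonneg)
  then show "AE w in M. norm (slots a b c e (X w)) \<le> norm (1 + cmod (X w) ^ 4)" by simp
qed

definition slot_moment :: "'w measure \<Rightarrow> ('w \<Rightarrow> complex) \<Rightarrow> bool \<Rightarrow> bool \<Rightarrow> bool \<Rightarrow> bool \<Rightarrow> complex" where
  "slot_moment M X a b c e = (\<integral>w. slots a b c e (X w) \<partial>M)"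

lemma slot_moment_values:
  assumes "prob_space M" "gaussian_moments M P v X"
  shows "slot_moment M X False False False False = 1"
    "slot_moment M X True False False False = 0"
    "slot_moment M X False True False False = 0"
    "slot_moment M X False False True False = 0"
    "slot_moment M X False False False True = 0"
    "slot_moment M X True True False False = of_real v"
    "slot_moment M X True False True False = of_real v"
    "slot_moment M X True False False True = of_bool (Crossed \<in> P) * of_real v"
    "slot_moment M X False True True False = of_bool (Crossed \<in> P) * of_real v"
    "slot_moment M X False True False True = of_real v"
    "slot_moment M X False False True True = of_real v"
    "slot_moment M X True True True True = of_nat (card P) * of_real (v\<^sup>2)"
proof -
  interpret prob_space M by fact
  note m = assms(2)[unfolded gaussian_moments_def]
  have m': "(\<integral>w. X w * cnj (X w) \<partial>M) = of_real v" using m by (simp add: mult.commute)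
  have "(\<integral>w. cnj (X w) * cnj (X w) \<partial>M) = cnj (\<integral>w. X w * X w \<partial>M)"
    using Bochner_Integration.integral_cnj[of M "\<lambda>w. X w * X w"] by simp
  with m have m'': "(\<integral>w. cnj (X w) * cnj (X w) \<partial>M) = of_bool (Crossed \<in> P) * of_real v" by simp
  show "slot_moment M X False False False False = 1"
    "slot_moment M X True False False False = 0"
    "slot_moment M X False True False False = 0"
    "slot_moment M X False False True False = 0"
    "slot_moment M X False False False True = 0"
    "slot_moment M X True True False False = of_real v"
    "slot_moment M X True False True False = of_real v"
    "slot_moment M X True False False True = of_bool (Crossed \<in> P) * of_real v"
    "slot_moment M X False True True False = of_bool (Crossed \<in> P) * of_real v"
    "slot_moment M X False True False True = of_real v"
    "slot_moment M X False False True True = of_real v"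
    "slot_moment M X True True True True = of_nat (card P) * of_real (v\<^sup>2)"
    using m m' m'' unfolding slot_moment_def slots_def by (simp_all add: prob_space)
qed

text \<open>Wick's formula within one core, checked for each pattern of coincidences among the four entries. An entry that occupies
  a single position contributes its mean 0; this covers all patterns except two pairs and a fourfold coincidence. In
  the latter all pairings match, in accordance with the fourth moment \<open>card P * v\<^sup>2\<close>.\<close>

lemma wick_single_core:
  fixes X :: "'i \<Rightarrow> 'w \<Rightarrow> complex"
  assumes M: "prob_space M" and I: "finite I" and P: "P = {Loops, Parallel} \<or> P = UNIV"
    and X: "\<And>x. x \<in> I \<Longrightarrow> gaussian_moments M P v (X x)"
    and e: "e1 \<in> I" "e2 \<in> I" "e3 \<in> I" "e4 \<in> I"
  shows "(\<Prod>x\<in>I. slot_moment M (X x) (x = e1) (x = e2) (x = e3) (x = e4))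
    = of_real (v\<^sup>2 * (\<Sum>q\<in>P. of_bool (matched q e1 e2 e3 e4)))"
proof -
  note moment_values = slot_moment_values[OF M X]
  have "(\<Prod>x\<in>I. slot_moment M (X x) (x = e1) (x = e2) (x = e3) (x = e4))
    = (\<Prod>x\<in>{e1, e2, e3, e4}. slot_moment M (X x) (x = e1) (x = e2) (x = e3) (x = e4))"
    using I e by (intro prod.mono_neutral_right) (auto simp: moment_values)
  also have "\<dots> = of_real (v\<^sup>2 * (\<Sum>q\<in>P. of_bool (matched q e1 e2 e3 e4)))"
    using P
  proof
    assume P: "P = {Loops, Parallel}"
    show ?thesis
      unfolding P
      by (cases "e1 = e2"; cases "e1 = e3"; cases "e1 = e4"; cases "e2 = e3"; cases "e2 = e4"; cases "e3 = e4")
         (use e in \<open>simp_all add: moment_values[unfolded P] power2_eq_square insert_commute\<close>)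
  next
    assume P: "P = UNIV"
    show ?thesis
      unfolding P UNIV_pairing
      by (cases "e1 = e2"; cases "e1 = e3"; cases "e1 = e4"; cases "e2 = e3"; cases "e2 = e4"; cases "e3 = e4")
         (use e in \<open>simp_all add: moment_values[unfolded P UNIV_pairing] power2_eq_square insert_commute\<close>)
  qed
  finally show ?thesis .
qed

lemma second_moment_single_core:
  fixes X :: "'i \<Rightarrow> 'w \<Rightarrow> complex"
  assumes M: "prob_space M" and I: "finite I"
    and X: "\<And>x. x \<in> I \<Longrightarrow> gaussian_moments M P v (X x)"
    and e: "e1 \<in> I" "e2 \<in> I"
  shows "(\<Prod>x\<in>I. slot_moment M (X x) (x = e1) (x = e2) False False) = of_real (v * of_bool (e1 = e2))"
proof -
  note moment_values = slot_moment_values[OF M X]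
  have "(\<Prod>x\<in>I. slot_moment M (X x) (x = e1) (x = e2) False False)
    = (\<Prod>x\<in>{e1, e2}. slot_moment M (X x) (x = e1) (x = e2) False False)"
    using I e by (intro prod.mono_neutral_right) (auto simp: moment_values)
  also have "\<dots> = of_real (v * of_bool (e1 = e2))"
    by (cases "e1 = e2") (use e in \<open>simp_all add: moment_values\<close>)
  finally show ?thesis .
qed

section \<open>Wick expansion over all cores\<close>

lemma finite_core_entries: "finite (core_entries n d \<chi>)"
proof (rule finite_subset)
  show "core_entries n d \<chi> \<subseteq> {1..n} \<times> {..\<chi> + 1} \<times> {..<d} \<times> {..\<chi> + 1}"
    by (auto simp: core_entries_def bond_dim_def split: if_splits)
qed auto

lemma fst_core_entries: "x \<in> core_entries n d \<chi> \<Longrightarrow> fst x \<in> {1..n}"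
  by (auto simp: core_entries_def)

definition selects_entries :: "nat \<Rightarrow> nat \<Rightarrow> nat \<Rightarrow> (nat \<Rightarrow> nat \<times> nat \<times> nat \<times> nat) \<Rightarrow> bool" where
  "selects_entries n d \<chi> e \<longleftrightarrow> (\<forall>p\<in>{1..n}. e p \<in> core_entries n d \<chi> \<and> fst (e p) = p)"

lemma selects_entriesD:
  "selects_entries n d \<chi> e \<Longrightarrow> p \<in> {1..n} \<Longrightarrow> e p \<in> core_entries n d \<chi> \<and> fst (e p) = p"
  by (simp add: selects_entries_def)

lemma prod_core_selection:
  fixes g :: "nat \<times> nat \<times> nat \<times> nat \<Rightarrow> 'a :: comm_monoid_mult"
  assumes "selects_entries n d \<chi> e"
  shows "(\<Prod>x\<in>core_entries n d \<chi>. if x = e (fst x) then g x else 1) = (\<Prod>p = 1..n. g (e p))"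
proof -
  have "(\<Prod>x\<in>core_entries n d \<chi>. if x = e (fst x) then g x else 1) = (\<Prod>x\<in>e ` {1..n}. g x)"
    using selects_entriesD[OF assms] finite_core_entries fst_core_entries
    by (intro prod.mono_neutral_cong_right) (auto simp: image_iff)
  also have "\<dots> = (\<Prod>p = 1..n. g (e p))"
    using selects_entriesD[OF assms] by (intro prod.reindex_cong[OF _ refl refl] inj_onI) metis
  finally show ?thesis .
qed

text \<open>The variance of a core splits evenly over its two bonds. This also describes the first and the last core, as
  the trivial outer bond has dimension 1.\<close>

lemma core_variance_eq:
  assumes "2 \<le> n" "1 \<le> p" "p \<le> n"
  shows "core_variance n \<chi> p = 1 / (sqrt (real (bond_dim n \<chi> (p - 1))) * sqrt (real (bond_dim n \<chi> p)))"
  using assms by (auto simp: core_variance_def bond_dim_def)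

lemma core_variance_square:
  assumes "2 \<le> n" "1 \<le> p" "p \<le> n"
  shows "(core_variance n \<chi> p)\<^sup>2 = 1 / real (bond_dim n \<chi> (p - 1)) * (1 / real (bond_dim n \<chi> p))"
  unfolding core_variance_eq[OF assms] by (simp add: power_divide power_mult_distrib)

text \<open>Normal cores over either field, seen as complex random variables; \<open>P\<close> records the field.\<close>

locale gaussian_cores = prob_space M for M :: "'w measure" +
  fixes n d \<chi> :: nat and P :: "pairing set" and G :: "nat \<times> nat \<times> nat \<times> nat \<Rightarrow> 'w \<Rightarrow> complex"
  assumes n: "2 \<le> n" and d: "1 \<le> d" and \<chi>: "1 \<le> \<chi>"
    and P: "P = {Loops, Parallel} \<or> P = UNIV"
    and indep: "indep_vars (\<lambda>_. borel) G (core_entries n d \<chi>)"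
    and moments: "\<And>x. x \<in> core_entries n d \<chi> \<Longrightarrow> gaussian_moments M P (core_variance n \<chi> (fst x)) (G x)"
begin

text \<open>One computation for the fourth moment (\<open>s\<close> true) and the second moment (\<open>s\<close> false, with the last two
  positions empty). The product over cores is rewritten as a product over all independent entries, and the
  expectations are then regrouped by cores.\<close>

lemma slots_product:
  fixes s :: bool
  assumes e1: "selects_entries n d \<chi> e1"
    and e2: "selects_entries n d \<chi> e2"
    and e3: "selects_entries n d \<chi> e3"
    and e4: "selects_entries n d \<chi> e4"
  defines "Z \<equiv> (\<lambda>w. (\<Prod>p = 1..n. cnj (G (e1 p) w)) * (\<Prod>p = 1..n. G (e2 p) w)
      * (if s then (\<Prod>p = 1..n. G (e3 p) w) * (\<Prod>p = 1..n. cnj (G (e4 p) w)) else 1))"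
  shows "integrable M Z"
    and "(\<integral>w. Z w \<partial>M) = (\<Prod>p = 1..n. \<Prod>x\<in>{x \<in> core_entries n d \<chi>. fst x = p}.
        slot_moment M (G x) (x = e1 p) (x = e2 p) (s \<and> x = e3 p) (s \<and> x = e4 p))"
proof -
  let ?I = "core_entries n d \<chi>"
  define Y where "Y x w = slots (x = e1 (fst x)) (x = e2 (fst x)) (s \<and> x = e3 (fst x)) (s \<and> x = e4 (fst x)) (G x w)" for x w
  have Z: "Z w = (\<Prod>x\<in>?I. Y x w)" for w
  proof -
    have "(\<Prod>x\<in>?I. Y x w) = (\<Prod>x\<in>?I. if x = e1 (fst x) then cnj (G x w) else 1)
        * (\<Prod>x\<in>?I. if x = e2 (fst x) then G x w else 1)
        * (if s then (\<Prod>x\<in>?I. if x = e3 (fst x) then G x w else 1)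
           * (\<Prod>x\<in>?I. if x = e4 (fst x) then cnj (G x w) else 1) else 1)"
      by (simp add: Y_def slots_def prod.distrib)
    then show ?thesis
      unfolding Z_def prod_core_selection[OF e1] prod_core_selection[OF e2]
        prod_core_selection[OF e3] prod_core_selection[OF e4] by simp
  qed
  have indep_Y: "indep_vars (\<lambda>_. borel) Y ?I"
    unfolding Y_def by (rule indep_vars_compose2[OF indep]) simp
  have int_Y: "integrable M (Y x)" if "x \<in> ?I" for x
    unfolding Y_def by (rule integrable_slots[OF finite_measure_axioms moments[OF that]])
  show "integrable M Z"
    unfolding Z by (rule indep_vars_integrable[OF finite_core_entries indep_Y int_Y])
  have "(\<integral>w. Z w \<partial>M) = (\<Prod>x\<in>?I. \<integral>w. Y x w \<partial>M)"
    unfolding Z by (rule indep_vars_lebesgue_integral[OF finite_core_entries indep_Y int_Y])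
  also have "\<dots> = (\<Prod>p = 1..n. \<Prod>x\<in>{x \<in> ?I. fst x = p}. \<integral>w. Y x w \<partial>M)"
    using fst_core_entries by (intro prod.group[symmetric] finite_core_entries) auto
  also have "\<dots> = (\<Prod>p = 1..n. \<Prod>x\<in>{x \<in> ?I. fst x = p}.
        slot_moment M (G x) (x = e1 p) (x = e2 p) (s \<and> x = e3 p) (s \<and> x = e4 p))"
    by (intro prod.cong refl) (auto simp: Y_def slot_moment_def)
  finally show "(\<integral>w. Z w \<partial>M) = \<dots>" .
qed

lemma wick_fourth:
  assumes e1: "selects_entries n d \<chi> e1"
    and e2: "selects_entries n d \<chi> e2"
    and e3: "selects_entries n d \<chi> e3"
    and e4: "selects_entries n d \<chi> e4"
  defines "Z \<equiv> (\<lambda>w. (\<Prod>p = 1..n. cnj (G (e1 p) w)) * (\<Prod>p = 1..n. G (e2 p) w)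
      * ((\<Prod>p = 1..n. G (e3 p) w) * (\<Prod>p = 1..n. cnj (G (e4 p) w))))"
  shows "integrable M Z"
    and "(\<integral>w. Z w \<partial>M) = of_real (\<Prod>p = 1..n. (core_variance n \<chi> p)\<^sup>2 * (\<Sum>q\<in>P. of_bool (matched q (e1 p) (e2 p) (e3 p) (e4 p))))"
proof -
  note sp = slots_product[OF e1 e2 e3 e4, where s = True, unfolded if_True, folded Z_def]
  show "integrable M Z" by (rule sp(1))
  show "(\<integral>w. Z w \<partial>M) = of_real (\<Prod>p = 1..n. (core_variance n \<chi> p)\<^sup>2 * (\<Sum>q\<in>P. of_bool (matched q (e1 p) (e2 p) (e3 p) (e4 p))))"
    unfolding sp(2) of_real_prod
  proof (intro prod.cong refl)
    fix p assume p: "p \<in> {1..n}"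
    show "(\<Prod>x\<in>{x \<in> core_entries n d \<chi>. fst x = p}. slot_moment M (G x) (x = e1 p) (x = e2 p) (True \<and> x = e3 p) (True \<and> x = e4 p))
      = of_real ((core_variance n \<chi> p)\<^sup>2 * (\<Sum>q\<in>P. of_bool (matched q (e1 p) (e2 p) (e3 p) (e4 p))))"
      unfolding simp_thms
      by (rule wick_single_core[OF prob_space_axioms _ P])
         (use finite_core_entries[of n d \<chi>] moments selects_entriesD[OF e1 p] selects_entriesD[OF e2 p] selects_entriesD[OF e3 p] selects_entriesD[OF e4 p] in auto)
  qed
qed

lemma wick_second:
  assumes e1: "selects_entries n d \<chi> e1"
    and e2: "selects_entries n d \<chi> e2"
  defines "Z \<equiv> (\<lambda>w. (\<Prod>p = 1..n. cnj (G (e1 p) w)) * (\<Prod>p = 1..n. G (e2 p) w))"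
  shows "integrable M Z"
    and "(\<integral>w. Z w \<partial>M) = of_real (\<Prod>p = 1..n. core_variance n \<chi> p * of_bool (e1 p = e2 p))"
proof -
  note sp = slots_product[OF e1 e2 e1 e2, where s = False, unfolded if_False mult_1_right, folded Z_def]
  show "integrable M Z" by (rule sp(1))
  show "(\<integral>w. Z w \<partial>M) = of_real (\<Prod>p = 1..n. core_variance n \<chi> p * of_bool (e1 p = e2 p))"
    unfolding sp(2) of_real_prod
  proof (intro prod.cong refl)
    fix p assume p: "p \<in> {1..n}"
    show "(\<Prod>x\<in>{x \<in> core_entries n d \<chi>. fst x = p}. slot_moment M (G x) (x = e1 p) (x = e2 p) (False \<and> x = e1 p) (False \<and> x = e2 p))
      = of_real (core_variance n \<chi> p * of_bool (e1 p = e2 p))"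
      unfolding simp_thms
      by (rule second_moment_single_core[OF prob_space_axioms, where P = P])
         (use finite_core_entries[of n d \<chi>] moments selects_entriesD[OF e1 p] selects_entriesD[OF e2 p] in auto)
  qed
qed


definition core_label :: "(nat \<Rightarrow> nat) \<Rightarrow> (nat \<Rightarrow> nat) \<Rightarrow> nat \<Rightarrow> nat \<times> nat \<times> nat \<times> nat" where
  "core_label \<alpha> i p = (p, \<alpha> (p - 1), i p, \<alpha> p)"

abbreviation bonds :: "(nat \<Rightarrow> nat) set" where
  "bonds \<equiv> PiE {0..n} (\<lambda>p. {..<bond_dim n \<chi> p})"

abbreviation entry :: "nat \<Rightarrow> 'w \<Rightarrow> complex" where
  "entry k w \<equiv> mps_entry n \<chi> (\<lambda>e. G e w) (multi_index n d k)"

lemma selects_core_label: "\<alpha> \<in> bonds \<Longrightarrow> selects_entries n d \<chi> (core_label \<alpha> (multi_index n d k))"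
  using d by (auto simp: selects_entries_def core_label_def core_entries_def multi_index_def PiE_iff)

lemma entry_eq: "entry k w = (\<Sum>\<alpha>\<in>bonds. \<Prod>p = 1..n. G (core_label \<alpha> (multi_index n d k) p) w)"
  by (simp add: mps_entry_def core_label_def)

lemma matched_core_label:
  "matched q (core_label \<alpha> i p) (core_label \<beta> j p) (core_label \<gamma> k p) (core_label \<delta> l p)
    \<longleftrightarrow> matched q (\<alpha> (p-1)) (\<beta> (p-1)) (\<gamma> (p-1)) (\<delta> (p-1)) \<and> matched q (i p) (j p) (k p) (l p)
      \<and> matched q (\<alpha> p) (\<beta> p) (\<gamma> p) (\<delta> p)"
  by (cases q) (auto simp: core_label_def)

lemma finite_bonds: "finite bonds"
  by (intro finite_PiE) auto

text \<open>The sums over the pairings of the single cores multiply out to a sum over words. The indicator that four labels are paired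
  splits into physical indices, which remain, and bond indices, which are summed out.\<close>

lemma entry_fourth_moment:
  fixes i j k l :: nat
  defines "Z \<equiv> (\<lambda>w. cnj (entry i w) * entry j w * (entry k w * cnj (entry l w)))"
  shows "integrable M Z"
    and "(\<integral>w. Z w \<partial>M) = of_real (\<Sum>q\<in>PiE {1..n} (\<lambda>_. P). of_bool (\<forall>p\<in>{1..n}. matched (q p)
        (multi_index n d i p) (multi_index n d j p) (multi_index n d k p) (multi_index n d l p)) * word_weight n \<chi> q)"
proof -
  let ?m = "multi_index n d"
  let ?lab = "\<lambda>\<alpha> k. core_label \<alpha> (?m k)"
  let ?T = "\<lambda>\<alpha> \<beta> \<gamma> \<delta> w. (\<Prod>p = 1..n. cnj (G (?lab \<alpha> i p) w)) * (\<Prod>p = 1..n. G (?lab \<beta> j p) w)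
      * ((\<Prod>p = 1..n. G (?lab \<gamma> k p) w) * (\<Prod>p = 1..n. cnj (G (?lab \<delta> l p) w)))"
  have Z: "Z = (\<lambda>w. \<Sum>\<alpha>\<in>bonds. \<Sum>\<beta>\<in>bonds. \<Sum>\<gamma>\<in>bonds. \<Sum>\<delta>\<in>bonds. ?T \<alpha> \<beta> \<gamma> \<delta> w)"
    unfolding Z_def entry_eq cnj_sum cnj_prod mult.assoc
    by (simp only: sum_distrib_right) (simp only: sum_distrib_left)
  have int: "integrable M (?T \<alpha> \<beta> \<gamma> \<delta>)" if "\<alpha> \<in> bonds" "\<beta> \<in> bonds" "\<gamma> \<in> bonds" "\<delta> \<in> bonds" for \<alpha> \<beta> \<gamma> \<delta>
    using that by (intro wick_fourth(1) selects_core_label)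
  show "integrable M Z"
    unfolding Z by (intro Bochner_Integration.integrable_sum int)
  define c where "c p = real (bond_dim n \<chi> p)" for p
  let ?X = "\<lambda>q \<alpha> \<beta> \<gamma> \<delta>. \<Prod>p = 1..n. of_bool (matched (q p) (\<alpha> (p-1)) (\<beta> (p-1)) (\<gamma> (p-1)) (\<delta> (p-1))) / c (p-1)
      * (of_bool (matched (q p) (\<alpha> p) (\<beta> p) (\<gamma> p) (\<delta> p)) / c p)"
  let ?b = "\<lambda>q. of_bool (\<forall>p\<in>{1..n}. matched (q p) (?m i p) (?m j p) (?m k p) (?m l p)) :: real"
  have wick: "(\<integral>w. ?T \<alpha> \<beta> \<gamma> \<delta> w \<partial>M) = of_real (\<Sum>q\<in>PiE {1..n} (\<lambda>_. P). ?b q * ?X q \<alpha> \<beta> \<gamma> \<delta>)"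
    if "\<alpha> \<in> bonds" "\<beta> \<in> bonds" "\<gamma> \<in> bonds" "\<delta> \<in> bonds" for \<alpha> \<beta> \<gamma> \<delta>
  proof -
    have "(\<Prod>p = 1..n. (core_variance n \<chi> p)\<^sup>2 * (\<Sum>q\<in>P. of_bool (matched q (?lab \<alpha> i p) (?lab \<beta> j p) (?lab \<gamma> k p) (?lab \<delta> l p))))
      = (\<Sum>q\<in>PiE {1..n} (\<lambda>_. P). \<Prod>p = 1..n. (core_variance n \<chi> p)\<^sup>2
          * of_bool (matched (q p) (?lab \<alpha> i p) (?lab \<beta> j p) (?lab \<gamma> k p) (?lab \<delta> l p)))"
      unfolding sum_distrib_left by (rule prod_sum_PiE) auto
    also have "\<dots> = (\<Sum>q\<in>PiE {1..n} (\<lambda>_. P). ?b q * ?X q \<alpha> \<beta> \<gamma> \<delta>)"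
    proof (intro sum.cong refl)
      fix q
      have "?b q * ?X q \<alpha> \<beta> \<gamma> \<delta> = (\<Prod>p = 1..n. of_bool (matched (q p) (?m i p) (?m j p) (?m k p) (?m l p))
         * (of_bool (matched (q p) (\<alpha> (p-1)) (\<beta> (p-1)) (\<gamma> (p-1)) (\<delta> (p-1))) / c (p-1)
           * (of_bool (matched (q p) (\<alpha> p) (\<beta> p) (\<gamma> p) (\<delta> p)) / c p)))"
        by (simp only: of_bool_ball[OF finite_atLeastAtMost, symmetric] prod.distrib)
      also have "\<dots> = (\<Prod>p = 1..n. (core_variance n \<chi> p)\<^sup>2
          * of_bool (matched (q p) (?lab \<alpha> i p) (?lab \<beta> j p) (?lab \<gamma> k p) (?lab \<delta> l p)))"
        by (intro prod.cong refl) (simp add: core_variance_square[OF n] matched_core_label of_bool_conj c_def)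
      finally show "(\<Prod>p = 1..n. (core_variance n \<chi> p)\<^sup>2
          * of_bool (matched (q p) (?lab \<alpha> i p) (?lab \<beta> j p) (?lab \<gamma> k p) (?lab \<delta> l p))) = ?b q * ?X q \<alpha> \<beta> \<gamma> \<delta>" ..
    qed
    finally show ?thesis using that by (subst wick_fourth(2)) (auto intro!: selects_core_label simp del: of_real_prod of_real_sum)
  qed
  have "(\<integral>w. Z w \<partial>M) = (\<Sum>\<alpha>\<in>bonds. \<Sum>\<beta>\<in>bonds. \<Sum>\<gamma>\<in>bonds. \<Sum>\<delta>\<in>bonds. \<integral>w. ?T \<alpha> \<beta> \<gamma> \<delta> w \<partial>M)"
    unfolding Z by (simp only: Bochner_Integration.integral_sum Bochner_Integration.integrable_sum int cong: sum.cong)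
  also have "\<dots> = of_real (\<Sum>\<alpha>\<in>bonds. \<Sum>\<beta>\<in>bonds. \<Sum>\<gamma>\<in>bonds. \<Sum>\<delta>\<in>bonds. \<Sum>q\<in>PiE {1..n} (\<lambda>_. P). ?b q * ?X q \<alpha> \<beta> \<gamma> \<delta>)"
    unfolding of_real_sum[of _ bonds] by (intro sum.cong refl wick)
  also have "(\<Sum>\<alpha>\<in>bonds. \<Sum>\<beta>\<in>bonds. \<Sum>\<gamma>\<in>bonds. \<Sum>\<delta>\<in>bonds. \<Sum>q\<in>PiE {1..n} (\<lambda>_. P). ?b q * ?X q \<alpha> \<beta> \<gamma> \<delta>)
      = (\<Sum>q\<in>PiE {1..n} (\<lambda>_. P). ?b q * (\<Sum>\<alpha>\<in>bonds. \<Sum>\<beta>\<in>bonds. \<Sum>\<gamma>\<in>bonds. \<Sum>\<delta>\<in>bonds. ?X q \<alpha> \<beta> \<gamma> \<delta>))"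
    unfolding sum_distrib_left sum.swap[of _ "PiE {1..n} (\<lambda>_. P)" bonds] ..
  also have "\<dots> = (\<Sum>q\<in>PiE {1..n} (\<lambda>_. P). ?b q * word_weight n \<chi> q)"
    unfolding c_def bond_sum_pairings[OF n \<chi>] ..
  finally show "(\<integral>w. Z w \<partial>M) = of_real (\<Sum>q\<in>PiE {1..n} (\<lambda>_. P). ?b q * word_weight n \<chi> q)" .
qed

text \<open>The labels of both factors must agree, which forces equal bond indices and equal digits; the number of bond configurations
  then cancels the product of the variances.\<close>

lemma entry_second_moment:
  assumes ij: "i < d ^ n" "j < d ^ n"
  shows "integrable M (\<lambda>w. cnj (entry i w) * entry j w)"
    and "(\<integral>w. cnj (entry i w) * entry j w \<partial>M) = of_bool (i = j)"
proof -
  let ?m = "multi_index n d"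
  let ?lab = "\<lambda>\<alpha> k. core_label \<alpha> (?m k)"
  let ?T = "\<lambda>\<alpha> \<beta> w. (\<Prod>p = 1..n. cnj (G (?lab \<alpha> i p) w)) * (\<Prod>p = 1..n. G (?lab \<beta> j p) w)"
  have Z: "(\<lambda>w. cnj (entry i w) * entry j w) = (\<lambda>w. \<Sum>\<alpha>\<in>bonds. \<Sum>\<beta>\<in>bonds. ?T \<alpha> \<beta> w)"
    unfolding entry_eq by (simp only: cnj_sum cnj_prod sum_product)
  have int: "integrable M (?T \<alpha> \<beta>)" if "\<alpha> \<in> bonds" "\<beta> \<in> bonds" for \<alpha> \<beta>
    using that by (intro wick_second(1) selects_core_label)
  show "integrable M (\<lambda>w. cnj (entry i w) * entry j w)"
    unfolding Z by (intro Bochner_Integration.integrable_sum int)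
  define V where "V = (\<Prod>p = 1..n. core_variance n \<chi> p)"
  have wick: "(\<integral>w. ?T \<alpha> \<beta> w \<partial>M) = of_real (of_bool (\<beta> = \<alpha>) * (of_bool (i = j) * V))"
    if "\<alpha> \<in> bonds" "\<beta> \<in> bonds" for \<alpha> \<beta>
  proof -
    have "(\<forall>p\<in>{1..n}. ?lab \<alpha> i p = ?lab \<beta> j p) \<longleftrightarrow> \<beta> = \<alpha> \<and> i = j"
    proof
      assume *: "\<forall>p\<in>{1..n}. ?lab \<alpha> i p = ?lab \<beta> j p"
      have "\<alpha> p = \<beta> p" if "p \<in> {0..n}" for p
        \<comment> \<open>Bond \<open>p\<close> is read off as the right bond of core \<open>p\<close>, and bond 0 as the left bond of core 1.\<close>
        using *[rule_format, of 1] *[rule_format, of p] that n by (cases "p = 0") (auto simp: core_label_def)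
      then have "\<alpha> = \<beta>" using that by (intro PiE_ext) auto
      moreover have "i = j" using * by (intro multi_index_eqD[OF d ij]) (auto simp: core_label_def)
      ultimately show "\<beta> = \<alpha> \<and> i = j" by simp
    qed simp
    then have "(\<Prod>p = 1..n. core_variance n \<chi> p * of_bool (?lab \<alpha> i p = ?lab \<beta> j p)) = of_bool (\<beta> = \<alpha>) * (of_bool (i = j) * V)"
      by (simp only: prod.distrib of_bool_ball[OF finite_atLeastAtMost] V_def of_bool_conj mult.commute mult.left_commute)
    then show ?thesis using that by (subst wick_second(2)) (auto intro!: selects_core_label simp del: of_real_prod of_real_mult)
  qed
  have "(\<integral>w. cnj (entry i w) * entry j w \<partial>M) = (\<Sum>\<alpha>\<in>bonds. \<Sum>\<beta>\<in>bonds. \<integral>w. ?T \<alpha> \<beta> w \<partial>M)"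
    unfolding Z by (simp only: Bochner_Integration.integral_sum Bochner_Integration.integrable_sum int cong: sum.cong)
  also have "\<dots> = of_real (\<Sum>\<alpha>\<in>bonds. \<Sum>\<beta>\<in>bonds. of_bool (\<beta> = \<alpha>) * (of_bool (i = j) * V))"
    unfolding of_real_sum[of _ bonds] by (intro sum.cong refl wick)
  also have "(\<Sum>\<alpha>\<in>bonds. \<Sum>\<beta>\<in>bonds. of_bool (\<beta> = \<alpha>) * (of_bool (i = j) * V)) = of_bool (i = j) * (real (card bonds) * V)"
    unfolding sum_of_bool_eq(1)[OF finite_bonds] by simp
  also have "real (card bonds) * V = 1"
  proof -
    have "V = (\<Prod>p = 1..n. 1 / (sqrt (real (bond_dim n \<chi> (p - 1))) * sqrt (real (bond_dim n \<chi> p))))"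
      unfolding V_def by (intro prod.cong refl core_variance_eq[OF n]) auto
    also have "\<dots> = 1 / (\<Prod>p = 0..n. real (bond_dim n \<chi> p))" by (rule prod_bond_dim)
    also have "(\<Prod>p = 0..n. real (bond_dim n \<chi> p)) = real (card bonds)" by (simp add: card_PiE)
    finally have "V = 1 / real (card bonds)" .
    moreover have "card bonds \<noteq> 0" using \<chi> by (simp add: card_PiE bond_dim_def)
    ultimately show ?thesis by simp
  qed
  finally show "(\<integral>w. cnj (entry i w) * entry j w \<partial>M) = of_bool (i = j)" by simp
qed

end

section \<open>The variance of a quadratic form\<close>

lemma of_real_of_bool: "of_real (of_bool b) = of_bool b"
  by (cases b) auto

context gaussian_cores
begin

abbreviation form :: "complex mat \<Rightarrow> 'w \<Rightarrow> complex" where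
  "form A w \<equiv> conjugate (mps_vec n d \<chi> (\<lambda>e. G e w)) \<bullet> (A *\<^sub>v mps_vec n d \<chi> (\<lambda>e. G e w))"

abbreviation words :: "(nat \<Rightarrow> pairing) set" where
  "words \<equiv> PiE {1..n} (\<lambda>_. P)"

abbreviation loops :: "nat \<Rightarrow> pairing" where
  "loops \<equiv> (\<lambda>p\<in>{1..n}. Loops)"

abbreviation gram :: "complex mat \<Rightarrow> nat \<Rightarrow> nat \<Rightarrow> nat \<Rightarrow> nat \<Rightarrow> complex" where
  "gram A i j k l \<equiv> A $$ (i, j) * cnj (A $$ (k, l))"

lemma form_eq:
  assumes "A \<in> carrier_mat (d ^ n) (d ^ n)"
  shows "form A w = (\<Sum>i<d ^ n. \<Sum>j<d ^ n. A $$ (i, j) * (cnj (entry i w) * entry j w))"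
proof -
  have "form A w = (\<Sum>i<d ^ n. cnj (entry i w) * (\<Sum>j<d ^ n. A $$ (i, j) * entry j w))"
    using assms by (simp add: mps_vec_def scalar_prod_def atLeast0LessThan)
  then show ?thesis by (simp only: sum_distrib_left mult.left_commute)
qed

lemma form_mean:
  assumes A: "A \<in> carrier_mat (d ^ n) (d ^ n)"
  shows "integrable M (form A)" and "(\<integral>w. form A w \<partial>M) = (\<Sum>i<d ^ n. A $$ (i, i))"
proof -
  have int: "integrable M (\<lambda>w. A $$ (i, j) * (cnj (entry i w) * entry j w))" if "i \<in> {..<d ^ n}" "j \<in> {..<d ^ n}" for i j
    using entry_second_moment(1)[of i j] that by (intro integrable_mult_right) simp
  show "integrable M (form A)"
    unfolding form_eq[OF A] by (intro Bochner_Integration.integrable_sum int)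
  have "(\<integral>w. form A w \<partial>M) = (\<Sum>i<d ^ n. \<Sum>j<d ^ n. \<integral>w. A $$ (i, j) * (cnj (entry i w) * entry j w) \<partial>M)"
    unfolding form_eq[OF A]
    by (simp only: Bochner_Integration.integral_sum Bochner_Integration.integrable_sum int cong: sum.cong)
  also have "\<dots> = (\<Sum>i<d ^ n. \<Sum>j<d ^ n. of_bool (i = j) * A $$ (i, j))"
    by (intro sum.cong refl) (simp add: entry_second_moment(2) mult.commute[of _ "A $$ _"])
  also have "\<dots> = (\<Sum>i<d ^ n. A $$ (i, i))"
    by (intro sum.cong refl) (simp only: sum_of_bool_eq(2) finite_lessThan, simp)
  finally show "(\<integral>w. form A w \<partial>M) = (\<Sum>i<d ^ n. A $$ (i, i))" .
qed

lemma form_second_moment: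
  assumes A: "A \<in> carrier_mat (d ^ n) (d ^ n)"
  shows "integrable M (\<lambda>w. (cmod (form A w))\<^sup>2)"
    and "of_real (\<integral>w. (cmod (form A w))\<^sup>2 \<partial>M) = (\<Sum>q\<in>words. of_real (word_weight n \<chi> q) * contraction n d q (gram A))"
proof -
  let ?N = "d ^ n"
  let ?Z = "\<lambda>i j k l w. cnj (entry i w) * entry j w * (entry k w * cnj (entry l w))"
  let ?b = "\<lambda>q i j k l. \<forall>p\<in>{1..n}. matched (q p) (multi_index n d i p) (multi_index n d j p)
    (multi_index n d k p) (multi_index n d l p)"
  \<comment> \<open>The conjugate of the form pairs \<open>k\<close> with \<open>l\<close> in the order \<open>\<omega>\<^sub>k cnj(\<omega>\<^sub>l)\<close>, which explains the positions of
    the conjugations in the fourth moment.\<close>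
  have sq: "(\<lambda>w. complex_of_real ((cmod (form A w))\<^sup>2))
    = (\<lambda>w. \<Sum>i<?N. \<Sum>j<?N. \<Sum>k<?N. \<Sum>l<?N. gram A i j k l * ?Z i j k l w)"
  proof
    fix w
    have "complex_of_real ((cmod (form A w))\<^sup>2)
      = (\<Sum>i<?N. \<Sum>j<?N. A $$ (i, j) * (cnj (entry i w) * entry j w))
        * (\<Sum>k<?N. \<Sum>l<?N. cnj (A $$ (k, l)) * (entry k w * cnj (entry l w)))"
      unfolding complex_norm_square form_eq[OF A] cnj_sum complex_cnj_mult complex_cnj_cnj ..
    also have "\<dots> = (\<Sum>i<?N. \<Sum>j<?N. \<Sum>k<?N. \<Sum>l<?N. gram A i j k l * ?Z i j k l w)"
      by (simp only: sum_distrib_right) (simp only: sum_distrib_left mult_ac)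
    finally show "complex_of_real ((cmod (form A w))\<^sup>2) = \<dots>" .
  qed
  have int: "integrable M (\<lambda>w. gram A i j k l * ?Z i j k l w)" for i j k l
    by (rule integrable_mult_right) (rule entry_fourth_moment(1))
  have "integrable M (\<lambda>w. complex_of_real ((cmod (form A w))\<^sup>2))"
    unfolding sq by (intro Bochner_Integration.integrable_sum int)
  from integrable_Re[OF this] show "integrable M (\<lambda>w. (cmod (form A w))\<^sup>2)" by (simp only: Re_complex_of_real)
  have "complex_of_real (\<integral>w. (cmod (form A w))\<^sup>2 \<partial>M) = (\<integral>w. complex_of_real ((cmod (form A w))\<^sup>2) \<partial>M)"
    by (rule integral_complex_of_real[symmetric])
  also have "\<dots> = (\<Sum>i<?N. \<Sum>j<?N. \<Sum>k<?N. \<Sum>l<?N. \<integral>w. gram A i j k l * ?Z i j k l w \<partial>M)"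
    unfolding sq by (simp only: Bochner_Integration.integral_sum Bochner_Integration.integrable_sum int cong: sum.cong)
  also have "\<dots> = (\<Sum>i<?N. \<Sum>j<?N. \<Sum>k<?N. \<Sum>l<?N. \<Sum>q\<in>words.
      of_real (word_weight n \<chi> q) * (of_bool (?b q i j k l) * gram A i j k l))"
  proof (intro sum.cong refl)
    fix i j k l
    have "(\<integral>w. gram A i j k l * ?Z i j k l w \<partial>M) = gram A i j k l * (\<integral>w. ?Z i j k l w \<partial>M)"
      by (rule integral_mult_right_zero)
    also have "\<dots> = (\<Sum>q\<in>words. of_real (word_weight n \<chi> q) * (of_bool (?b q i j k l) * gram A i j k l))"
      unfolding entry_fourth_moment(2) of_real_sum sum_distrib_left of_real_mult of_real_of_bool
      by (intro sum.cong refl) (simp only: mult_ac)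
    finally show "(\<integral>w. gram A i j k l * ?Z i j k l w \<partial>M) = \<dots>" .
  qed
  also have "\<dots> = (\<Sum>q\<in>words. of_real (word_weight n \<chi> q) * contraction n d q (gram A))"
    unfolding contraction_def sum_distrib_left sum.swap[of _ words "{..<?N}"] ..
  finally show "of_real (\<integral>w. (cmod (form A w))\<^sup>2 \<partial>M) = \<dots>" .
qed

lemma Loops_in_P: "Loops \<in> P"
  using P by auto

text \<open>The word consisting of \<open>Loops\<close> only has weight 1 and contracts \<open>A\<close> to \<open>\<bar>tr A\<bar>\<^sup>2\<close>, the square of the modulus
  of the mean; it is exactly what the variance subtracts.\<close>

lemma form_variance:
  assumes A: "A \<in> carrier_mat (d ^ n) (d ^ n)"
  shows "of_real (rv_variance M (form A))
    = (\<Sum>q\<in>words - {loops}. of_real (word_weight n \<chi> q) * contraction n d q (gram A))"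
proof -
  have "contraction n d loops (gram A) = (\<Sum>i<d ^ n. A $$ (i, i)) * cnj (\<Sum>k<d ^ n. A $$ (k, k))"
    unfolding cnj_sum sum_product by (rule contraction_loops[OF d]) simp
  also have "\<dots> = of_real ((cmod (\<integral>w. form A w \<partial>M))\<^sup>2)"
    unfolding form_mean(2)[OF A] complex_norm_square ..
  finally have "complex_of_real ((cmod (\<integral>w. form A w \<partial>M))\<^sup>2)
    = of_real (word_weight n \<chi> loops) * contraction n d loops (gram A)"
    by (simp only: word_weight_const of_real_1 mult_1_left)
  moreover have "loops \<in> words" using Loops_in_P by auto
  then have "(\<Sum>q\<in>words. of_real (word_weight n \<chi> q) * contraction n d q (gram A))
    = of_real (word_weight n \<chi> loops) * contraction n d loops (gram A)
      + (\<Sum>q\<in>words - {loops}. of_real (word_weight n \<chi> q) * contraction n d q (gram A))"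
    by (intro sum.remove) (auto intro: finite_PiE)
  ultimately show ?thesis
    unfolding rv_variance_def of_real_diff form_second_moment(2)[OF A] by simp
qed

lemma form_finite_variance:
  assumes A: "A \<in> carrier_mat (d ^ n) (d ^ n)"
  shows "finite_variance M (form A)"
  unfolding finite_variance_def
  by (intro conjI borel_measurable_integrable form_mean(1)[OF A] form_second_moment(1)[OF A])

abbreviation weight_with :: "real \<Rightarrow> real" where
  "weight_with r \<equiv> r * (1 + (r - 1) / real \<chi>) ^ (n - 1)"

text \<open>The words other than \<open>loops\<close> fall into those without any \<open>Loops\<close>, bounded by the Frobenius norm, and the mixed
  ones, bounded by the nuclear norm.\<close>

lemma word_weight_split:
  defines "r \<equiv> real (card P)" and "W0 \<equiv> PiE {1..n} (\<lambda>_. P - {Loops})"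
  shows "W0 \<subseteq> words - {loops}"
    and "(\<Sum>q\<in>W0. word_weight n \<chi> q) = weight_with (r - 1)"
    and "(\<Sum>q\<in>words - {loops} - W0. word_weight n \<chi> q) = weight_with r - weight_with (r - 1) - 1"
proof -
  have fin: "finite words" by (intro finite_PiE) auto
  show sub: "W0 \<subseteq> words - {loops}"
  proof
    fix q assume q: "q \<in> W0"
    then have "q 1 \<noteq> Loops" using n by (auto simp: W0_def PiE_iff)
    then have "q \<noteq> loops" using n by auto
    with q show "q \<in> words - {loops}" by (auto simp: W0_def PiE_iff)
  qed
  have ne: "P - {Loops} \<noteq> {}" using P by auto
  have c: "real (card (P - {Loops})) = r - 1"
    using P by (auto simp: r_def UNIV_pairing)
  show w0: "(\<Sum>q\<in>W0. word_weight n \<chi> q) = weight_with (r - 1)"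
    unfolding W0_def c[symmetric] using n by (intro sum_word_weight ne) auto
  have wall: "(\<Sum>q\<in>words. word_weight n \<chi> q) = weight_with r"
    unfolding r_def using n Loops_in_P by (intro sum_word_weight) auto
  have "loops \<in> words" using Loops_in_P by auto
  then have "(\<Sum>q\<in>words. word_weight n \<chi> q) = 1 + (\<Sum>q\<in>words - {loops}. word_weight n \<chi> q)"
    using fin by (subst sum.remove[of _ loops]) (auto simp only: word_weight_const)
  moreover have "(\<Sum>q\<in>words - {loops}. word_weight n \<chi> q)
    = (\<Sum>q\<in>words - {loops} - W0. word_weight n \<chi> q) + (\<Sum>q\<in>W0. word_weight n \<chi> q)"
    using fin by (intro sum.subset_diff sub) auto
  ultimately show "(\<Sum>q\<in>words - {loops} - W0. word_weight n \<chi> q) = weight_with r - weight_with (r - 1) - 1"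
    using w0 wall by simp
qed

lemma form_variance_bound:
  fixes A :: "complex mat"
  assumes A: "A \<in> carrier_mat (d ^ n) (d ^ n)"
  defines "r \<equiv> real (card P)"
  shows "rv_variance M (form A) \<le> weight_with (r - 1) * (frobenius_norm A)\<^sup>2
    + (weight_with r - weight_with (r - 1) - 1) * (nuclear_norm A)\<^sup>2"
proof -
  let ?W0 = "PiE {1..n} (\<lambda>_. P - {Loops})"
  have fin: "finite words" by (intro finite_PiE) auto
  have "rv_variance M (form A) = Re (of_real (rv_variance M (form A)))" by simp
  also have "\<dots> \<le> cmod (of_real (rv_variance M (form A)))" by (rule complex_Re_le_cmod)
  also have "\<dots> \<le> (\<Sum>q\<in>words - {loops}. word_weight n \<chi> q * cmod (contraction n d q (gram A)))"
    unfolding form_variance[OF A]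
    by (intro sum_norm_le) (simp add: norm_mult word_weight_nonneg)
  also have "\<dots> = (\<Sum>q\<in>words - {loops} - ?W0. word_weight n \<chi> q * cmod (contraction n d q (gram A)))
    + (\<Sum>q\<in>?W0. word_weight n \<chi> q * cmod (contraction n d q (gram A)))"
    using fin by (intro sum.subset_diff word_weight_split(1)) auto
  also have "\<dots> \<le> (\<Sum>q\<in>words - {loops} - ?W0. word_weight n \<chi> q * (nuclear_norm A)\<^sup>2)
    + (\<Sum>q\<in>?W0. word_weight n \<chi> q * (frobenius_norm A)\<^sup>2)"
    by (intro add_mono sum_mono mult_left_mono word_weight_nonneg
        contraction_nuclear_bound[OF d A] contraction_frobenius_norm_bound[OF d A]) auto
  also have "\<dots> = weight_with (r - 1) * (frobenius_norm A)\<^sup>2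
    + (weight_with r - weight_with (r - 1) - 1) * (nuclear_norm A)\<^sup>2"
    unfolding sum_distrib_right[symmetric] word_weight_split(2,3) r_def by simp
  finally show ?thesis .
qed

text \<open>Every contraction of the matrix of ones counts the index quadruples matched by a word, and there are
  \<open>d\<^sup>2\<close> of them per site for each pairing. As both norms of this matrix equal its size, both estimates in the
  bound become equalities.\<close>

lemma form_variance_all_ones:
  defines "r \<equiv> real (card P)" and "J \<equiv> all_ones_mat (d ^ n)"
  shows "rv_variance M (form J) = weight_with (r - 1) * (frobenius_norm J)\<^sup>2
    + (weight_with r - weight_with (r - 1) - 1) * (nuclear_norm J)\<^sup>2"
proof -
  let ?W0 = "PiE {1..n} (\<lambda>_. P - {Loops})" and ?N = "real (d ^ n)"
  have fin: "finite words" by (intro finite_PiE) auto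
  have J: "J \<in> carrier_mat (d ^ n) (d ^ n)" and J1: "\<And>i j. i < d ^ n \<Longrightarrow> j < d ^ n \<Longrightarrow> J $$ (i, j) = 1"
    by (auto simp: J_def all_ones_mat_def)
  have nuc: "nuclear_norm J = ?N" unfolding J_def by (rule nuclear_norm_all_ones)
  have frob: "(frobenius_norm J)\<^sup>2 = ?N\<^sup>2"
    using J by (auto simp: frobenius_norm_def J1 sum_nonneg power2_eq_square)
  have C: "contraction n d q (gram J) = of_real (?N\<^sup>2)" for q
  proof -
    have "contraction n d q (gram J) = of_real (contraction n d q (\<lambda>i j k l. 1))"
      unfolding contraction_def of_real_sum of_real_mult of_real_of_bool
      by (intro sum.cong refl) (simp add: J1)
    then show ?thesis by (simp only: contraction_ones[OF d])
  qed
  have "complex_of_real (rv_variance M (form J)) = of_real (\<Sum>q\<in>words - {loops}. word_weight n \<chi> q * ?N\<^sup>2)"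
    unfolding form_variance[OF J] C of_real_sum of_real_mult ..
  then have "rv_variance M (form J) = (\<Sum>q\<in>words - {loops}. word_weight n \<chi> q * ?N\<^sup>2)"
    unfolding of_real_eq_iff .
  also have "\<dots> = (\<Sum>q\<in>words - {loops} - ?W0. word_weight n \<chi> q * ?N\<^sup>2) + (\<Sum>q\<in>?W0. word_weight n \<chi> q * ?N\<^sup>2)"
    using fin by (intro sum.subset_diff word_weight_split(1)) auto
  also have "\<dots> = weight_with (r - 1) * ?N\<^sup>2 + (weight_with r - weight_with (r - 1) - 1) * ?N\<^sup>2"
    unfolding sum_distrib_right[symmetric] word_weight_split(2,3) r_def by simp
  finally show ?thesis unfolding frob nuc .
qed

end

section \<open>Real and complex normal laws\<close>

lemma gaussian_moments_distr:
  assumes X: "X \<in> measurable M N" and Y [measurable]: "Y \<in> borel_measurable N"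
  shows "gaussian_moments (distr M N X) P v Y \<longleftrightarrow> gaussian_moments M P v (\<lambda>w. Y (X w))"
proof -
  have m: "integral\<^sup>L (distr M N X) f = (\<integral>w. f (X w) \<partial>M)" if "f \<in> borel_measurable N" for f :: "_ \<Rightarrow> complex"
    using X that by (rule integral_distr)
  have [measurable]: "cnj \<in> borel_measurable borel"
    by (intro borel_measurable_continuous_onI continuous_intros)
  have "integrable (distr M N X) (\<lambda>w. cmod (Y w) ^ 4) \<longleftrightarrow> integrable M (\<lambda>w. cmod (Y (X w)) ^ 4)"
    using X by (intro integrable_distr_eq) auto
  moreover have "(\<integral>w. Y w \<partial>distr M N X) = (\<integral>w. Y (X w) \<partial>M)"
    "(\<integral>w. cnj (Y w) * Y w \<partial>distr M N X) = (\<integral>w. cnj (Y (X w)) * Y (X w) \<partial>M)"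
    "(\<integral>w. Y w * Y w \<partial>distr M N X) = (\<integral>w. Y (X w) * Y (X w) \<partial>M)"
    "(\<integral>w. cnj (Y w) * Y w * (Y w * cnj (Y w)) \<partial>distr M N X)
      = (\<integral>w. cnj (Y (X w)) * Y (X w) * (Y (X w) * cnj (Y (X w))) \<partial>M)"
    by (rule m; measurable)+
  ultimately show ?thesis
    using Y X unfolding gaussian_moments_def by simp
qed

lemma real_normal_law_moments:
  assumes v: "v > 0"
  shows "integrable (real_normal_law v) (\<lambda>x. x ^ k)"
    and "(\<integral>x. x ^ 0 \<partial>real_normal_law v) = 1"
    and "(\<integral>x. x ^ 1 \<partial>real_normal_law v) = 0"
    and "(\<integral>x. x ^ 2 \<partial>real_normal_law v) = v"
    and "(\<integral>x. x ^ 4 \<partial>real_normal_law v) = 3 * v\<^sup>2"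
proof -
  have s: "sqrt v > 0" using v by simp
  have e: "(\<integral>x. x ^ k \<partial>real_normal_law v) = (\<integral>x. normal_density 0 (sqrt v) x * x ^ k \<partial>lborel)" for k
    unfolding real_normal_law_def by (subst integral_density) auto
  show "integrable (real_normal_law v) (\<lambda>x. x ^ k)"
    unfolding real_normal_law_def using integrable_normal_moment[OF s, of 0 k]
    by (subst integrable_density) auto
  show "(\<integral>x. x ^ 0 \<partial>real_normal_law v) = 1"
    unfolding e using integral_normal_moment_even[OF s, of 0 0] by simp
  show "(\<integral>x. x ^ 1 \<partial>real_normal_law v) = 0"
    unfolding e using integral_normal_moment_odd[OF s, of 0 0] by simp
  show "(\<integral>x. x ^ 2 \<partial>real_normal_law v) = v"
    unfolding e using integral_normal_moment_even[OF s, of 0 1] v by (simp add: fact_numeral)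
  show "(\<integral>x. x ^ 4 \<partial>real_normal_law v) = 3 * v\<^sup>2"
    unfolding e using integral_normal_moment_even[OF s, of 0 2] v
    by (simp add: fact_numeral power_divide field_simps)
qed

lemma prob_space_real_normal_law: "v > 0 \<Longrightarrow> prob_space (real_normal_law v)"
  unfolding real_normal_law_def by (rule prob_space_normal_density) simp

lemma sets_real_normal_law [measurable_cong, simp]: "sets (real_normal_law v) = sets borel"
  by (simp add: real_normal_law_def)

lemma gaussian_moments_real:
  assumes v: "v > 0"
  shows "gaussian_moments (real_normal_law v) UNIV v complex_of_real"
proof -
  note m = real_normal_law_moments[OF v]
  have c: "card (UNIV :: pairing set) = 3" by (simp add: UNIV_pairing)
  have i: "(\<integral>x. complex_of_real x ^ k \<partial>real_normal_law v) = of_real (\<integral>x. x ^ k \<partial>real_normal_law v)" for k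
    by (simp only: of_real_power[symmetric] integral_complex_of_real)
  have "(\<integral>x. complex_of_real x \<partial>real_normal_law v) = 0" using i[of 1] m(3) by simp
  moreover have "(\<integral>x. complex_of_real x * of_real x \<partial>real_normal_law v) = of_real v"
    using i[of 2] m(4) by (simp add: power2_eq_square)
  moreover have "(\<integral>x. complex_of_real x * of_real x * (of_real x * of_real x) \<partial>real_normal_law v) = 3 * of_real (v\<^sup>2)"
    using i[of 4] m(5) by (simp add: power4_eq_xxxx mult.assoc)
  moreover have "integrable (real_normal_law v) (\<lambda>x. cmod (complex_of_real x) ^ 4)"
    using m(1)[of 4] by simp
  ultimately show ?thesis by (simp add: gaussian_moments_def c)
qed

text \<open>All moments involved are polynomials in the real and imaginary part, whose mixed moments factorise.\<close>

lemma gaussian_moments_complex: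
  assumes v: "v > 0"
  shows "gaussian_moments (complex_normal_law v) {Loops, Parallel} v (\<lambda>z. z)"
proof -
  let ?L = "real_normal_law (v / 2)"
  let ?LL = "?L \<Otimes>\<^sub>M ?L"
  have v2: "v / 2 > 0" using v by simp
  interpret L: prob_space ?L by (rule prob_space_real_normal_law[OF v2])
  interpret LL: pair_prob_space ?L ?L ..
  note m = real_normal_law_moments[OF v2]
  have int: "integrable ?LL (\<lambda>(x, y). x ^ a * y ^ b)" for a b
  proof (rule LL.Fubini_integrable)
    show "(\<lambda>(x, y). x ^ a * y ^ b) \<in> borel_measurable ?LL" by measurable
    have "(\<lambda>x. \<integral>y. norm (case (x, y) of (x, y) \<Rightarrow> x ^ a * y ^ b) \<partial>?L)
      = (\<lambda>x. \<bar>x ^ a\<bar> * (\<integral>y. \<bar>y ^ b\<bar> \<partial>?L))"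
      by (simp add: abs_mult)
    then show "integrable ?L (\<lambda>x. \<integral>y. norm (case (x, y) of (x, y) \<Rightarrow> x ^ a * y ^ b) \<partial>?L)"
      using integrable_abs[OF m(1)[of a]] by simp
    show "AE x in ?L. integrable ?L (\<lambda>y. case (x, y) of (x, y) \<Rightarrow> x ^ a * y ^ b)"
      using m(1)[of b] by simp
  qed
  have mom: "(\<integral>(x, y). x ^ a * y ^ b \<partial>?LL) = (\<integral>x. x ^ a \<partial>?L) * (\<integral>y. y ^ b \<partial>?L)" for a b
    using LL.integral_fst'[OF int[of a b]] by simp
  have intc: "integrable ?LL (\<lambda>(x, y). complex_of_real (x ^ a * y ^ b))" for a b
    using integrable_of_real[OF int[of a b], where 'a = complex] by (simp add: split_def)
  have momc: "(\<integral>(x, y). complex_of_real (x ^ a * y ^ b) \<partial>?LL) = of_real ((\<integral>x. x ^ a \<partial>?L) * (\<integral>y. y ^ b \<partial>?L))" for a b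
    unfolding mom[symmetric] split_def by (rule integral_complex_of_real)
  note intc' = intc[unfolded split_def] and momc' = momc[unfolded split_def]
  \<comment> \<open>All integrands are written as combinations of monomials \<open>x\<^sup>a y\<^sup>b\<close>, trivial exponents included,
    to match the formula for the mixed moments.\<close>
  have C: "Complex x y = of_real (x ^ 1 * y ^ 0) + \<i> * of_real (x ^ 0 * y ^ 1)" for x y
    by (simp add: complex_eq_iff)
  have m1: "(\<integral>(x, y). Complex x y \<partial>?LL) = 0"
    unfolding split_def C
    by (simp only: intc' momc' integrable_mult_right integral_mult_right_zero m(2,3) Bochner_Integration.integral_add) simp
  have "Complex x y * Complex x y = of_real (x ^ 2 * y ^ 0) + (2 * \<i> * of_real (x ^ 1 * y ^ 1) - of_real (x ^ 0 * y ^ 2))" for x y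
    by (simp add: complex_eq_iff power2_eq_square)
  then have m2: "(\<integral>(x, y). Complex x y * Complex x y \<partial>?LL) = 0"
    unfolding split_def
    by (simp only: intc' momc' integrable_mult_right integral_mult_right_zero m(2,3,4)
        Bochner_Integration.integral_add Bochner_Integration.integral_diff Bochner_Integration.integrable_add Bochner_Integration.integrable_diff) simp
  have "cnj (Complex x y) * Complex x y = of_real (x ^ 2 * y ^ 0) + of_real (x ^ 0 * y ^ 2)" for x y
    by (simp add: complex_eq_iff power2_eq_square)
  then have m3: "(\<integral>(x, y). cnj (Complex x y) * Complex x y \<partial>?LL) = of_real v"
    unfolding split_def
    by (simp only: intc' momc' m(2,3,4) Bochner_Integration.integral_add) simp
  have "cnj (Complex x y) * Complex x y * (Complex x y * cnj (Complex x y))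
      = of_real (x ^ 4 * y ^ 0) + (2 * of_real (x ^ 2 * y ^ 2) + of_real (x ^ 0 * y ^ 4))" for x y
    by (simp add: complex_eq_iff power2_eq_square power4_eq_xxxx algebra_simps)
  then have m4: "(\<integral>(x, y). cnj (Complex x y) * Complex x y * (Complex x y * cnj (Complex x y)) \<partial>?LL) = 2 * of_real (v\<^sup>2)"
    unfolding split_def
    by (simp only: intc' momc' integrable_mult_right integral_mult_right_zero m(2,4,5)
        Bochner_Integration.integral_add Bochner_Integration.integrable_add) (simp add: power2_eq_square)
  have "cmod (Complex x y) ^ 4 = x ^ 4 * y ^ 0 + (2 * (x ^ 2 * y ^ 2) + x ^ 0 * y ^ 4)" for x y
  proof -
    have "cmod (Complex x y) ^ 4 = ((cmod (Complex x y))\<^sup>2)\<^sup>2" by simp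
    also have "\<dots> = (x\<^sup>2 + y\<^sup>2)\<^sup>2" by (simp add: cmod_power2)
    finally show ?thesis by (simp add: power2_sum algebra_simps)
  qed
  then have i4: "integrable ?LL (\<lambda>(x, y). cmod (Complex x y) ^ 4)"
    unfolding split_def
    by (simp only: int[unfolded split_def] integrable_mult_right Bochner_Integration.integrable_add)
  have meas: "(\<lambda>(x, y). Complex x y) \<in> borel_measurable ?LL"
    unfolding split_def C by measurable
  have "gaussian_moments ?LL {Loops, Parallel} v (\<lambda>w. (case w of (x, y) \<Rightarrow> Complex x y))"
    using m1 m2 m3 m4 i4 meas by (simp add: gaussian_moments_def split_def)
  then show ?thesis
    unfolding complex_normal_law_def using meas by (subst gaussian_moments_distr) auto
qed

section \<open>The variance bound\<close>

lemma rv_variance_cong: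
  assumes "\<And>w. w \<in> space M \<Longrightarrow> X w = Y w"
  shows "rv_variance M X = rv_variance M Y"
proof -
  have "(\<integral>w. (norm (X w))\<^sup>2 \<partial>M) = (\<integral>w. (norm (Y w))\<^sup>2 \<partial>M)"
    by (rule Bochner_Integration.integral_cong) (simp_all add: assms)
  moreover have "(\<integral>w. X w \<partial>M) = (\<integral>w. Y w \<partial>M)"
    by (rule Bochner_Integration.integral_cong) (simp_all add: assms)
  ultimately show ?thesis by (simp only: rv_variance_def)
qed

lemma finite_variance_cong:
  assumes "\<And>w. w \<in> space M \<Longrightarrow> X w = Y w"
  shows "finite_variance M X \<longleftrightarrow> finite_variance M Y"
proof -
  have "X \<in> borel_measurable M \<longleftrightarrow> Y \<in> borel_measurable M"
    by (rule measurable_cong) (rule assms)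
  moreover have "integrable M (\<lambda>w. (norm (X w))\<^sup>2) \<longleftrightarrow> integrable M (\<lambda>w. (norm (Y w))\<^sup>2)"
    by (rule Bochner_Integration.integrable_cong) (simp_all add: assms)
  ultimately show ?thesis by (simp only: finite_variance_def)
qed

lemma rv_variance_of_real: "rv_variance M (\<lambda>w. complex_of_real (X w)) = rv_variance M X"
  by (simp add: rv_variance_def)

lemma finite_variance_of_real: "finite_variance M (\<lambda>w. complex_of_real (X w)) \<longleftrightarrow> finite_variance M X"
proof -
  have "(\<lambda>w. complex_of_real (X w)) \<in> borel_measurable M \<longleftrightarrow> X \<in> borel_measurable M"
  proof
    assume "(\<lambda>w. complex_of_real (X w)) \<in> borel_measurable M"
    from measurable_compose[OF this borel_measurable_Re] show "X \<in> borel_measurable M" by simp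
  qed measurable
  then show ?thesis by (simp only: finite_variance_def norm_of_real real_norm_def)
qed

lemma core_variance_pos: "1 \<le> \<chi> \<Longrightarrow> core_variance n \<chi> p > 0"
  by (simp add: core_variance_def)

lemma gaussian_cores_of_law:
  assumes "prob_space M" and "2 \<le> n" "1 \<le> d" "1 \<le> \<chi>"
    and P: "P = {Loops, Parallel} \<or> P = UNIV"
    and indep: "prob_space.indep_vars M (\<lambda>_. borel) G (core_entries n d \<chi>)"
    and law: "\<forall>(p, \<alpha>, i, \<beta>) \<in> core_entries n d \<chi>. distr M borel (G (p, \<alpha>, i, \<beta>)) = N (core_variance n \<chi> p)"
    and f: "f \<in> borel_measurable borel"
    and N: "\<And>v. v > 0 \<Longrightarrow> gaussian_moments (N v) P v f"
  shows "gaussian_cores M n d \<chi> P (\<lambda>x w. f (G x w))"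
proof -
  interpret prob_space M by fact
  show ?thesis
  proof
    show "indep_vars (\<lambda>_. borel) (\<lambda>x w. f (G x w)) (core_entries n d \<chi>)"
      by (rule indep_vars_compose2[OF indep f])
    fix x assume x: "x \<in> core_entries n d \<chi>"
    have G: "G x \<in> borel_measurable M" using indep x by (simp add: indep_vars_def)
    have "distr M borel (G x) = N (core_variance n \<chi> (fst x))" using law x by auto
    then have "gaussian_moments (distr M borel (G x)) P (core_variance n \<chi> (fst x)) f"
      using N core_variance_pos[OF \<open>1 \<le> \<chi>\<close>] by simp
    then show "gaussian_moments M P (core_variance n \<chi> (fst x)) (\<lambda>w. f (G x w))"
      by (simp only: gaussian_moments_distr[OF G f])
  qed (use assms in auto)
qed

lemma mps_vec_of_real:
  "mps_vec n d \<chi> (\<lambda>e. complex_of_real (G e)) = map_vec complex_of_real (mps_vec n d \<chi> G)"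
  by (rule eq_vecI) (simp_all add: mps_vec_def mps_entry_def)

lemma quadratic_form_of_real:
  fixes A :: "real mat" and x :: "real vec"
  assumes "A \<in> carrier_mat N N" "x \<in> carrier_vec N"
  shows "conjugate (map_vec complex_of_real x) \<bullet> (map_mat complex_of_real A *\<^sub>v map_vec complex_of_real x)
    = complex_of_real (x \<bullet> (A *\<^sub>v x))"
  using assms by (auto simp: scalar_prod_def intro!: sum.cong)

theorem theorem1p2:
  fixes n d \<chi> :: nat
    and M\<^sub>R :: "'w measure" and \<omega>\<^sub>R :: "'w \<Rightarrow> real vec"
    and M\<^sub>C :: "'v measure" and \<omega>\<^sub>C :: "'v \<Rightarrow> complex vec"
  assumes "2 \<le> n" and "1 \<le> d" and "1 \<le> \<chi>"
  shows "(is_rmps real_normal_law M\<^sub>R n d \<chi> \<omega>\<^sub>R \<longrightarrow>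
      (\<forall>A \<in> carrier_mat (d ^ n) (d ^ n).
        let Q = (\<lambda>w. \<omega>\<^sub>R w \<bullet> (A *\<^sub>v \<omega>\<^sub>R w));
            B = 2 * (1 + 1 / real \<chi>) ^ (n - 1) * (frobenius_norm A)\<^sup>2
              + (3 * (1 + 2 / real \<chi>) ^ (n - 1) - 2 * (1 + 1 / real \<chi>) ^ (n - 1) - 1)
                * (nuclear_norm A)\<^sup>2
        in finite_variance M\<^sub>R Q \<and> rv_variance M\<^sub>R Q \<le> B
           \<and> (A = all_ones_mat (d ^ n) \<longrightarrow> rv_variance M\<^sub>R Q = B)))
    \<and> (is_rmps complex_normal_law M\<^sub>C n d \<chi> \<omega>\<^sub>C \<longrightarrow>
      (\<forall>A \<in> carrier_mat (d ^ n) (d ^ n).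
        let Q = (\<lambda>w. conjugate (\<omega>\<^sub>C w) \<bullet> (A *\<^sub>v \<omega>\<^sub>C w));
            B = (frobenius_norm A)\<^sup>2
              + 2 * ((1 + 1 / real \<chi>) ^ (n - 1) - 1) * (nuclear_norm A)\<^sup>2
        in finite_variance M\<^sub>C Q \<and> rv_variance M\<^sub>C Q \<le> B
           \<and> (A = all_ones_mat (d ^ n) \<longrightarrow> rv_variance M\<^sub>C Q = B)))"
proof (intro conjI impI)
  assume rmps: "is_rmps real_normal_law M\<^sub>R n d \<chi> \<omega>\<^sub>R"
  then obtain G where M: "prob_space M\<^sub>R"
    and G: "prob_space.indep_vars M\<^sub>R (\<lambda>_. borel) G (core_entries n d \<chi>)"
      "\<forall>(p, \<alpha>, i, \<beta>) \<in> core_entries n d \<chi>. distr M\<^sub>R borel (G (p, \<alpha>, i, \<beta>)) = real_normal_law (core_variance n \<chi> p)"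
    and \<omega>: "\<forall>w\<in>space M\<^sub>R. \<omega>\<^sub>R w = mps_vec n d \<chi> (\<lambda>e. G e w)"
    unfolding is_rmps_def by blast
  interpret gaussian_cores M\<^sub>R n d \<chi> UNIV "\<lambda>x w. complex_of_real (G x w)"
    by (rule gaussian_cores_of_law[OF M assms _ G, where f = complex_of_real])
       (auto intro: gaussian_moments_real)
  have r: "real (card (UNIV :: pairing set)) = 3" by (simp add: UNIV_pairing)
  show "\<forall>A \<in> carrier_mat (d ^ n) (d ^ n).
        let Q = (\<lambda>w. \<omega>\<^sub>R w \<bullet> (A *\<^sub>v \<omega>\<^sub>R w));
            B = 2 * (1 + 1 / real \<chi>) ^ (n - 1) * (frobenius_norm A)\<^sup>2
              + (3 * (1 + 2 / real \<chi>) ^ (n - 1) - 2 * (1 + 1 / real \<chi>) ^ (n - 1) - 1)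
                * (nuclear_norm A)\<^sup>2
        in finite_variance M\<^sub>R Q \<and> rv_variance M\<^sub>R Q \<le> B
           \<and> (A = all_ones_mat (d ^ n) \<longrightarrow> rv_variance M\<^sub>R Q = B)"
    unfolding Let_def
  proof (intro ballI)
    fix A :: "real mat" assume A: "A \<in> carrier_mat (d ^ n) (d ^ n)"
    let ?A = "map_mat complex_of_real A" and ?Q = "\<lambda>w. \<omega>\<^sub>R w \<bullet> (A *\<^sub>v \<omega>\<^sub>R w)"
    have A': "?A \<in> carrier_mat (d ^ n) (d ^ n)" using A by simp
    have form: "complex_of_real (?Q w) = form ?A w" if "w \<in> space M\<^sub>R" for w
      unfolding mps_vec_of_real \<omega>[rule_format, OF that]
      by (rule quadratic_form_of_real[OF A, symmetric]) (simp add: mps_vec_def)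
    let ?B = "2 * (1 + 1 / real \<chi>) ^ (n - 1) * (frobenius_norm A)\<^sup>2
      + (3 * (1 + 2 / real \<chi>) ^ (n - 1) - 2 * (1 + 1 / real \<chi>) ^ (n - 1) - 1) * (nuclear_norm A)\<^sup>2"
    note norms = nuclear_norm_of_real[OF A, symmetric] frobenius_norm_of_real[of A, symmetric]
    have var: "rv_variance M\<^sub>R ?Q = rv_variance M\<^sub>R (form ?A)"
      using rv_variance_cong[of M\<^sub>R, OF form] by (simp only: rv_variance_of_real)
    have "finite_variance M\<^sub>R ?Q"
      using finite_variance_cong[of M\<^sub>R, OF form] form_finite_variance[OF A'] by (simp only: finite_variance_of_real)
    moreover have "rv_variance M\<^sub>R ?Q \<le> ?B"
      unfolding var using form_variance_bound[OF A'] by (simp add: r norms)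
    moreover have "rv_variance M\<^sub>R ?Q = ?B" if "A = all_ones_mat (d ^ n)"
    proof -
      have "?A = all_ones_mat (d ^ n)"
        unfolding that by (rule eq_matI) (simp_all add: all_ones_mat_def)
      then show ?thesis unfolding var using form_variance_all_ones by (simp add: r norms)
    qed
    ultimately show "finite_variance M\<^sub>R ?Q \<and> rv_variance M\<^sub>R ?Q \<le> ?B
      \<and> (A = all_ones_mat (d ^ n) \<longrightarrow> rv_variance M\<^sub>R ?Q = ?B)" by blast
  qed
next
  assume rmps: "is_rmps complex_normal_law M\<^sub>C n d \<chi> \<omega>\<^sub>C"
  then obtain G where M: "prob_space M\<^sub>C"
    and G: "prob_space.indep_vars M\<^sub>C (\<lambda>_. borel) G (core_entries n d \<chi>)"
      "\<forall>(p, \<alpha>, i, \<beta>) \<in> core_entries n d \<chi>. distr M\<^sub>C borel (G (p, \<alpha>, i, \<beta>)) = complex_normal_law (core_variance n \<chi> p)"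
    and \<omega>: "\<forall>w\<in>space M\<^sub>C. \<omega>\<^sub>C w = mps_vec n d \<chi> (\<lambda>e. G e w)"
    unfolding is_rmps_def by blast
  interpret gaussian_cores M\<^sub>C n d \<chi> "{Loops, Parallel}" G
    by (rule gaussian_cores_of_law[OF M assms _ G, where f = "\<lambda>z. z"])
       (auto intro: gaussian_moments_complex)
  have r: "real (card {Loops, Parallel}) = 2" by simp
  show "\<forall>A \<in> carrier_mat (d ^ n) (d ^ n).
        let Q = (\<lambda>w. conjugate (\<omega>\<^sub>C w) \<bullet> (A *\<^sub>v \<omega>\<^sub>C w));
            B = (frobenius_norm A)\<^sup>2
              + 2 * ((1 + 1 / real \<chi>) ^ (n - 1) - 1) * (nuclear_norm A)\<^sup>2
        in finite_variance M\<^sub>C Q \<and> rv_variance M\<^sub>C Q \<le> B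
           \<and> (A = all_ones_mat (d ^ n) \<longrightarrow> rv_variance M\<^sub>C Q = B)"
    unfolding Let_def
  proof (intro ballI)
    fix A :: "complex mat" assume A: "A \<in> carrier_mat (d ^ n) (d ^ n)"
    let ?Q = "\<lambda>w. conjugate (\<omega>\<^sub>C w) \<bullet> (A *\<^sub>v \<omega>\<^sub>C w)"
    have form: "?Q w = form A w" if "w \<in> space M\<^sub>C" for w
      using \<omega> that by simp
    have "rv_variance M\<^sub>C ?Q = rv_variance M\<^sub>C (form A)" by (rule rv_variance_cong[OF form])
    moreover have "finite_variance M\<^sub>C ?Q"
      using finite_variance_cong[of M\<^sub>C, OF form] form_finite_variance[OF A] by simp
    ultimately show "finite_variance M\<^sub>C ?Q \<and> rv_variance M\<^sub>C ?Q
        \<le> (frobenius_norm A)\<^sup>2 + 2 * ((1 + 1 / real \<chi>) ^ (n - 1) - 1) * (nuclear_norm A)\<^sup>2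
      \<and> (A = all_ones_mat (d ^ n) \<longrightarrow> rv_variance M\<^sub>C ?Q
        = (frobenius_norm A)\<^sup>2 + 2 * ((1 + 1 / real \<chi>) ^ (n - 1) - 1) * (nuclear_norm A)\<^sup>2)"
      using form_variance_bound[OF A] form_variance_all_ones by (auto simp: r algebra_simps)
  qed
qed

end
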